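(* Let $A$ be a Banach algebra. If $A$ has the property $\mathbb{B}$, then $A$ has the property $\beta$.
   Context: Banach algebras are complex and associative, not necessarily unital. $\mathrm{rad}(A)$ denotes the Jacobson radical of $A$. A Banach algebra $A$ has the property $\mathbb{B}$ if for every Banach space $X$, every continuous bilinear map $\varphi\colon A\times A\to X$ such that for all $a,b\in A$, $ab=0$ implies $\varphi(a,b)=0$, necessarily satisfies $\varphi(ab,c)=\varphi(a,bc)$ for all $a,b,c\in A$. A Banach algebra $A$ has the property $\beta$ if there exists a family $(\pi_i)_{i\in I}$ of continuous irreducible representations of $A$ on Banach spaces $X_i$ such that: (a) $\bigcap_{i}\ker\pi_i=\mathrm{rad}(A)$; and (b) for each $i$ with $\dim X_i\ge 2$ there exists $q\in A$ such that $q^2=0$ and $\pi_i(q)\neq 0$. Here irreducible means algebraically irreducible (the representation is nonzero and there are no invariant linear subspaces other than $\{0\}$ and $X_i$). The family may be empty, in which case the intersection in (a) is understood to be $A$. *)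

theory Defs
  imports "HOL-Analysis.Analysis" "HOL-Algebra.Module"
begin

section \<open>Complex Banach algebras\<close>

text \<open>
  Not necessarily unital: \<open>real_normed_algebra\<close> has no unit. The real scalar multiplication
  of the superclass is the restriction of \<open>scaleC\<close>.
\<close>

class complex_banach_algebra = real_normed_algebra + banach +
  fixes scaleC :: "complex \<Rightarrow> 'a \<Rightarrow> 'a" (infixr \<open>*\<^sub>C\<close> 75)
  assumes scaleC_add_right: "c *\<^sub>C (x + y) = c *\<^sub>C x + c *\<^sub>C y"
    and scaleC_add_left: "(c + d) *\<^sub>C x = c *\<^sub>C x + d *\<^sub>C x"
    and scaleC_scaleC: "c *\<^sub>C d *\<^sub>C x = (c * d) *\<^sub>C x"
    and scaleC_of_real: "complex_of_real r *\<^sub>C x = r *\<^sub>R x"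
    and mult_scaleC_left: "(c *\<^sub>C x) * y = c *\<^sub>C (x * y)"
    and mult_scaleC_right: "x * (c *\<^sub>C y) = c *\<^sub>C (x * y)"
    and norm_scaleC: "norm (c *\<^sub>C x) = cmod c * norm x"

definition left_ideal :: "'a::complex_banach_algebra set \<Rightarrow> bool" where
  "left_ideal L \<longleftrightarrow> 0 \<in> L \<and> (\<forall>x\<in>L. \<forall>y\<in>L. x + y \<in> L) \<and> (\<forall>c. \<forall>x\<in>L. c *\<^sub>C x \<in> L)
     \<and> (\<forall>a. \<forall>x\<in>L. a * x \<in> L)"

text \<open>
  Every left ideal containing a modular one is modular, so a modular left ideal that is maximal
  among the modular proper left ideals is maximal among all proper left ideals.
\<close>

definition maximal_modular_left_ideal :: "'a::complex_banach_algebra set \<Rightarrow> bool" where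
  "maximal_modular_left_ideal L \<longleftrightarrow>
     left_ideal L \<and> L \<noteq> UNIV \<and> (\<exists>u. \<forall>a. a - a * u \<in> L) \<and>
     (\<forall>M. left_ideal M \<longrightarrow> L \<subseteq> M \<longrightarrow> M = L \<or> M = UNIV)"

text \<open>
  The Jacobson radical of a possibly non-unital algebra; it is the whole algebra if there are
  no maximal modular left ideals.
\<close>

definition jacobson_radical :: "'a::complex_banach_algebra set" where
  "jacobson_radical = \<Inter> {L. maximal_modular_left_ideal L}"


section \<open>Banach spaces with explicit carrier\<close>

text \<open>
  The Banach spaces \<open>X\<close> are quantified over inside the two properties below, so they are
  structures on a carrier set and not types. The fields \<open>mult\<close> and \<open>one\<close> inherited from the
  record of rings are irrelevant for a vector space; they are used only for \<open>bounded_ops\<close>.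
\<close>

definition complex_ring :: "complex ring" where
  "complex_ring = \<lparr>carrier = UNIV, mult = (*), one = 1, zero = 0, add = (+)\<rparr>"

record 'x normed_module = "(complex, 'x) module" +
  vnorm :: "'x \<Rightarrow> real"

text \<open>The locale \<open>Metric_space\<close> wants nonnegativity and symmetry also outside the carrier.\<close>

definition norm_dist :: "('x, 'm) normed_module_scheme \<Rightarrow> 'x \<Rightarrow> 'x \<Rightarrow> real" where
  "norm_dist V x y = (if x \<in> carrier V \<and> y \<in> carrier V then vnorm V (x \<ominus>\<^bsub>V\<^esub> y) else 0)"

definition norm_topology :: "('x, 'm) normed_module_scheme \<Rightarrow> 'x topology" where
  "norm_topology V = Metric_space.mtopology (carrier V) (norm_dist V)"

locale complex_normed_space = module complex_ring V for V :: "('x, 'm) normed_module_scheme" (structure) +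
  assumes vnorm_nonneg: "x \<in> carrier V \<Longrightarrow> 0 \<le> vnorm V x"
    and vnorm_eq_0: "x \<in> carrier V \<Longrightarrow> vnorm V x = 0 \<longleftrightarrow> x = \<zero>"
    and vnorm_triangle:
      "\<lbrakk>x \<in> carrier V; y \<in> carrier V\<rbrakk> \<Longrightarrow> vnorm V (x \<oplus> y) \<le> vnorm V x + vnorm V y"
    and vnorm_smult: "x \<in> carrier V \<Longrightarrow> vnorm V (c \<odot> x) = cmod c * vnorm V x"

locale complex_banach_space = complex_normed_space +
  assumes complete: "Metric_space.mcomplete (carrier V) (norm_dist V)"

definition bounded_ops :: "('x, 'm) normed_module_scheme \<Rightarrow> ('x \<Rightarrow> 'x) normed_module" where
  "bounded_ops V = \<lparr>
     carrier = {T \<in> carrier V \<rightarrow>\<^sub>E carrier V.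
        (\<forall>x\<in>carrier V. \<forall>y\<in>carrier V. T (x \<oplus>\<^bsub>V\<^esub> y) = T x \<oplus>\<^bsub>V\<^esub> T y) \<and>
        (\<forall>c. \<forall>x\<in>carrier V. T (c \<odot>\<^bsub>V\<^esub> x) = c \<odot>\<^bsub>V\<^esub> T x) \<and>
        (\<exists>K. \<forall>x\<in>carrier V. vnorm V (T x) \<le> K * vnorm V x)},
     mult = (\<lambda>S T. \<lambda>x\<in>carrier V. S (T x)),
     one = (\<lambda>x\<in>carrier V. x),
     zero = (\<lambda>x\<in>carrier V. \<zero>\<^bsub>V\<^esub>),
     add = (\<lambda>S T. \<lambda>x\<in>carrier V. S x \<oplus>\<^bsub>V\<^esub> T x),
     smult = (\<lambda>c T. \<lambda>x\<in>carrier V. c \<odot>\<^bsub>V\<^esub> T x),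
     vnorm = (\<lambda>T. SUP x\<in>{x \<in> carrier V. vnorm V x \<le> 1}. vnorm V (T x))\<rparr>"

text \<open>Includes infinite-dimensional spaces, for which a numerical dimension would be \<open>0\<close>.\<close>

definition dim_at_least :: "nat \<Rightarrow> ('x, 'm) normed_module_scheme \<Rightarrow> bool" where
  "dim_at_least n V \<longleftrightarrow> (\<exists>v. v \<in> {..<n} \<rightarrow> carrier V \<and>
     (\<forall>c. (\<Oplus>\<^bsub>V\<^esub> i \<in> {..<n}. c i \<odot>\<^bsub>V\<^esub> v i) = \<zero>\<^bsub>V\<^esub> \<longrightarrow> (\<forall>i<n. c i = 0)))"


section \<open>The property B\<close>

definition continuous_bilinear ::
    "('x, 'm) normed_module_scheme \<Rightarrow> ('a::complex_banach_algebra \<Rightarrow> 'a \<Rightarrow> 'x) \<Rightarrow> bool" where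
  "continuous_bilinear X \<phi> \<longleftrightarrow>
     (\<forall>a b. \<phi> a b \<in> carrier X) \<and>
     (\<forall>a a' b. \<phi> (a + a') b = \<phi> a b \<oplus>\<^bsub>X\<^esub> \<phi> a' b) \<and>
     (\<forall>a b b'. \<phi> a (b + b') = \<phi> a b \<oplus>\<^bsub>X\<^esub> \<phi> a b') \<and>
     (\<forall>c a b. \<phi> (c *\<^sub>C a) b = c \<odot>\<^bsub>X\<^esub> \<phi> a b) \<and>
     (\<forall>c a b. \<phi> a (c *\<^sub>C b) = c \<odot>\<^bsub>X\<^esub> \<phi> a b) \<and>
     continuous_map euclidean (norm_topology X) (\<lambda>(a, b). \<phi> a b)"

definition property_B_on :: "'a::complex_banach_algebra itself \<Rightarrow> 'x itself \<Rightarrow> bool" where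
  "property_B_on _ _ \<longleftrightarrow>
     (\<forall>(X :: 'x normed_module) (\<phi> :: 'a \<Rightarrow> 'a \<Rightarrow> 'x).
        complex_banach_space X \<longrightarrow> continuous_bilinear X \<phi> \<longrightarrow>
        (\<forall>a b. a * b = 0 \<longrightarrow> \<phi> a b = \<zero>\<^bsub>X\<^esub>) \<longrightarrow>
        (\<forall>a b c. \<phi> (a * b) c = \<phi> a (b * c)))"

text \<open>
  All Banach spaces whose elements come from the type \<open>nat \<Rightarrow> 'a\<close> are considered. This is no
  restriction, see \<open>property_B_imp_property_B_on\<close> below: up to isometric isomorphism these include
  the closed linear spans of the ranges of all continuous bilinear maps on \<open>'a\<close>.
\<close>

definition property_B :: "'a::complex_banach_algebra itself \<Rightarrow> bool" where
  "property_B A \<longleftrightarrow> property_B_on A TYPE(nat \<Rightarrow> 'a)"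


section \<open>The property \<open>\<beta>\<close>\<close>

definition continuous_representation ::
    "('x, 'm) normed_module_scheme \<Rightarrow> ('a::complex_banach_algebra \<Rightarrow> 'x \<Rightarrow> 'x) \<Rightarrow> bool" where
  "continuous_representation X \<pi> \<longleftrightarrow>
     (\<forall>a. \<pi> a \<in> carrier (bounded_ops X)) \<and>
     (\<forall>a b. \<pi> (a + b) = \<pi> a \<oplus>\<^bsub>bounded_ops X\<^esub> \<pi> b) \<and>
     (\<forall>c a. \<pi> (c *\<^sub>C a) = c \<odot>\<^bsub>bounded_ops X\<^esub> \<pi> a) \<and>
     (\<forall>a b. \<pi> (a * b) = \<pi> a \<otimes>\<^bsub>bounded_ops X\<^esub> \<pi> b) \<and>
     continuous_map euclidean (norm_topology (bounded_ops X)) \<pi>"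

definition rep_kernel ::
    "('x, 'm) normed_module_scheme \<Rightarrow> ('a::complex_banach_algebra \<Rightarrow> 'x \<Rightarrow> 'x) \<Rightarrow> 'a set" where
  "rep_kernel X \<pi> = {a. \<pi> a = \<zero>\<^bsub>bounded_ops X\<^esub>}"

definition irreducible_rep ::
    "('x, 'm) normed_module_scheme \<Rightarrow> ('a::complex_banach_algebra \<Rightarrow> 'x \<Rightarrow> 'x) \<Rightarrow> bool" where
  "irreducible_rep X \<pi> \<longleftrightarrow>
     (\<exists>a. \<pi> a \<noteq> \<zero>\<^bsub>bounded_ops X\<^esub>) \<and>
     (\<forall>Y. submodule Y complex_ring X \<longrightarrow> (\<forall>a. \<pi> a ` Y \<subseteq> Y) \<longrightarrow>
        Y = {\<zero>\<^bsub>X\<^esub>} \<or> Y = carrier X)"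

definition property_beta_on ::
    "'a::complex_banach_algebra itself \<Rightarrow> 'i itself \<Rightarrow> 'x itself \<Rightarrow> bool" where
  "property_beta_on _ _ _ \<longleftrightarrow>
     (\<exists>(I :: 'i set) (X :: 'i \<Rightarrow> 'x normed_module) (\<pi> :: 'i \<Rightarrow> 'a \<Rightarrow> 'x \<Rightarrow> 'x).
        (\<forall>i\<in>I. complex_banach_space (X i) \<and> continuous_representation (X i) (\<pi> i)
               \<and> irreducible_rep (X i) (\<pi> i)) \<and>
        (\<Inter>i\<in>I. rep_kernel (X i) (\<pi> i)) = jacobson_radical \<and>
        (\<forall>i\<in>I. dim_at_least 2 (X i) \<longrightarrow>
           (\<exists>q. q * q = 0 \<and> \<pi> i q \<noteq> \<zero>\<^bsub>bounded_ops (X i)\<^esub>)))"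

text \<open>
  Here the restriction to fixed types only makes an existential statement more specific; it is
  again immaterial (\<open>property_beta_on_imp_property_beta\<close>). One representation per kernel suffices,
  which gives the index type \<open>'a set\<close>, and an irreducible representation space is an image of \<open>'a\<close>.
\<close>

definition property_beta :: "'a::complex_banach_algebra itself \<Rightarrow> bool" where
  "property_beta A \<longleftrightarrow> property_beta_on A TYPE('a set) TYPE(nat \<Rightarrow> 'a)"


section \<open>Sanity of the definitions\<close>

lemma cring_complex_ring: "cring complex_ring"
proof (intro cringI abelian_groupI comm_monoidI)
  fix x :: complex show "\<exists>y\<in>carrier complex_ring. y \<oplus>\<^bsub>complex_ring\<^esub> x = \<zero>\<^bsub>complex_ring\<^esub>"
    by (rule bexI[of _ "-x"]) (auto simp: complex_ring_def)
qed (auto simp: complex_ring_def algebra_simps)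

context complex_normed_space
begin

lemma smult_closed' [simp]: "x \<in> carrier V \<Longrightarrow> c \<odot> x \<in> carrier V"
  using smult_closed[of c x] by (simp add: complex_ring_def)

lemma smult_l_distr': "x \<in> carrier V \<Longrightarrow> (c + d) \<odot> x = c \<odot> x \<oplus> d \<odot> x"
  using smult_l_distr[of c d x] by (simp add: complex_ring_def)

lemma smult_r_distr': "x \<in> carrier V \<Longrightarrow> y \<in> carrier V \<Longrightarrow> c \<odot> (x \<oplus> y) = c \<odot> x \<oplus> c \<odot> y"
  using smult_r_distr[of c x y] by (simp add: complex_ring_def)

lemma smult_assoc': "x \<in> carrier V \<Longrightarrow> c \<odot> (d \<odot> x) = (c * d) \<odot> x"
  using smult_assoc1[of c d x] by (simp add: complex_ring_def)

lemma smult_one' [simp]: "x \<in> carrier V \<Longrightarrow> 1 \<odot> x = x"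
  using smult_one[of x] by (simp add: complex_ring_def)

lemma smult_zero_left' [simp]: "x \<in> carrier V \<Longrightarrow> 0 \<odot> x = \<zero>"
  using smult_l_null[of x] by (simp add: complex_ring_def)

lemma smult_zero_right' [simp]: "c \<odot> \<zero> = \<zero>"
  using smult_r_null[of c] by (simp add: complex_ring_def)

lemma a_inv_eq: "x \<in> carrier V \<Longrightarrow> \<ominus> x = (-1) \<odot> x"
  using smult_l_distr'[of x "-1" 1] M.minus_equality[of "(-1) \<odot> x" x] by simp

lemma norm_dist_eq: "\<lbrakk>x \<in> carrier V; y \<in> carrier V\<rbrakk> \<Longrightarrow> norm_dist V x y = vnorm V (x \<oplus> (-1) \<odot> y)"
  by (simp add: norm_dist_def a_minus_def a_inv_eq)

lemma vnorm_zero [simp]: "vnorm V \<zero> = 0"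
  using vnorm_eq_0[of \<zero>] by simp

lemma Metric_space_norm_dist: "Metric_space (carrier V) (norm_dist V)"
proof
  fix x y
  show "0 \<le> norm_dist V x y"
    by (auto simp: norm_dist_def intro!: vnorm_nonneg)
  show "norm_dist V x y = norm_dist V y x"
  proof (cases "x \<in> carrier V \<and> y \<in> carrier V")
    case True
    then have "x \<oplus> (-1) \<odot> y = (-1) \<odot> (y \<oplus> (-1) \<odot> x)"
      by (simp add: smult_r_distr' smult_assoc' M.a_comm)
    then show ?thesis
      using True vnorm_smult[of "y \<oplus> (-1) \<odot> x" "-1"] by (simp add: norm_dist_eq)
  qed (auto simp: norm_dist_def)
next
  fix x y assume xy: "x \<in> carrier V" "y \<in> carrier V"
  have "x \<ominus> y = \<zero> \<longleftrightarrow> x = y"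
  proof
    assume "x \<ominus> y = \<zero>"
    then have "x = \<ominus> (\<ominus> y)"
      using xy M.minus_equality[of x "\<ominus> y"] by (simp add: a_minus_def)
    then show "x = y" using xy by simp
  next
    assume "x = y" then show "x \<ominus> y = \<zero>"
      using xy by (simp add: a_minus_def M.r_neg)
  qed
  then show "norm_dist V x y = 0 \<longleftrightarrow> x = y"
    using xy vnorm_eq_0[of "x \<ominus> y"] by (simp add: norm_dist_def)
next
  fix x y z assume xyz: "x \<in> carrier V" "y \<in> carrier V" "z \<in> carrier V"
  have "x \<ominus> z = (x \<ominus> y) \<oplus> (y \<ominus> z)"
  proof -
    have "(x \<ominus> y) \<oplus> (y \<ominus> z) = x \<oplus> ((\<ominus> y \<oplus> y) \<oplus> \<ominus> z)"
      using xyz by (simp add: a_minus_def M.a_assoc)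
    also have "\<dots> = x \<ominus> z" using xyz by (simp add: M.l_neg a_minus_def)
    finally show ?thesis by simp
  qed
  then show "norm_dist V x z \<le> norm_dist V x y + norm_dist V y z"
    using vnorm_triangle[of "x \<ominus> y" "y \<ominus> z"] xyz by (simp add: norm_dist_def)
qed

lemma topspace_norm_topology [simp]: "topspace (norm_topology V) = carrier V"
  by (simp add: norm_topology_def Metric_space.topspace_mtopology[OF Metric_space_norm_dist])

lemma limitin_norm_topology:
  "limitin (norm_topology V) \<sigma> l F \<longleftrightarrow>
     l \<in> carrier V \<and> (\<forall>e>0. \<forall>\<^sub>F n in F. \<sigma> n \<in> carrier V \<and> norm_dist V (\<sigma> n) l < e)"
  by (simp add: norm_topology_def Metric_space.limitin_metric[OF Metric_space_norm_dist])

lemma continuous_map_norm_topology: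
  "continuous_map T (norm_topology V) f \<longleftrightarrow>
     (\<forall>x\<in>topspace T. \<forall>e>0. \<exists>U. openin T U \<and> x \<in> U \<and>
        (\<forall>y\<in>U. f x \<in> carrier V \<and> f y \<in> carrier V \<and> norm_dist V (f x) (f y) < e))"
  by (simp add: norm_topology_def Metric_space.continuous_map_to_metric[OF Metric_space_norm_dist]
      Metric_space.in_mball[OF Metric_space_norm_dist])

end

lemma complex_normed_spaceI:
  fixes V :: "('x, 'm) normed_module_scheme" (structure)
  assumes "\<zero> \<in> carrier V"
    and "\<And>x y. x \<in> carrier V \<Longrightarrow> y \<in> carrier V \<Longrightarrow> x \<oplus> y \<in> carrier V"
    and "\<And>c x. x \<in> carrier V \<Longrightarrow> c \<odot> x \<in> carrier V"
    and "\<And>x y. x \<in> carrier V \<Longrightarrow> y \<in> carrier V \<Longrightarrow> x \<oplus> y = y \<oplus> x"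
    and "\<And>x y z. x \<in> carrier V \<Longrightarrow> y \<in> carrier V \<Longrightarrow> z \<in> carrier V \<Longrightarrow>
           (x \<oplus> y) \<oplus> z = x \<oplus> (y \<oplus> z)"
    and "\<And>x. x \<in> carrier V \<Longrightarrow> \<zero> \<oplus> x = x"
    and "\<And>x. x \<in> carrier V \<Longrightarrow> (-1) \<odot> x \<oplus> x = \<zero>"
    and "\<And>c d x. x \<in> carrier V \<Longrightarrow> (c + d) \<odot> x = c \<odot> x \<oplus> d \<odot> x"
    and "\<And>c x y. x \<in> carrier V \<Longrightarrow> y \<in> carrier V \<Longrightarrow> c \<odot> (x \<oplus> y) = c \<odot> x \<oplus> c \<odot> y"
    and "\<And>c d x. x \<in> carrier V \<Longrightarrow> (c * d) \<odot> x = c \<odot> (d \<odot> x)"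
    and "\<And>x. x \<in> carrier V \<Longrightarrow> 1 \<odot> x = x"
    and "\<And>x. x \<in> carrier V \<Longrightarrow> 0 \<le> vnorm V x"
    and "\<And>x. x \<in> carrier V \<Longrightarrow> vnorm V x = 0 \<longleftrightarrow> x = \<zero>"
    and "\<And>x y. x \<in> carrier V \<Longrightarrow> y \<in> carrier V \<Longrightarrow> vnorm V (x \<oplus> y) \<le> vnorm V x + vnorm V y"
    and "\<And>c x. x \<in> carrier V \<Longrightarrow> vnorm V (c \<odot> x) = cmod c * vnorm V x"
  shows "complex_normed_space V"
proof (rule complex_normed_space.intro)
  show "module complex_ring V"
  proof (rule moduleI[OF cring_complex_ring])
    show "abelian_group V"
    proof (rule abelian_groupI)
      fix x assume "x \<in> carrier V"
      then show "\<exists>y\<in>carrier V. y \<oplus> x = \<zero>"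
        using assms(3,7) by blast
    qed (use assms in auto)
  qed (use assms in \<open>auto simp: complex_ring_def\<close>)
  show "complex_normed_space_axioms V"
    by standard (use assms in auto)
qed


text \<open>The bounded operators with the operator norm form a normed space.\<close>

context complex_normed_space
begin

abbreviation "B \<equiv> bounded_ops V"

lemma carrier_B: "T \<in> carrier B \<longleftrightarrow> T \<in> carrier V \<rightarrow>\<^sub>E carrier V \<and>
        (\<forall>x\<in>carrier V. \<forall>y\<in>carrier V. T (x \<oplus> y) = T x \<oplus> T y) \<and>
        (\<forall>c. \<forall>x\<in>carrier V. T (c \<odot> x) = c \<odot> T x) \<and>
        (\<exists>K. \<forall>x\<in>carrier V. vnorm V (T x) \<le> K * vnorm V x)"
  by (simp add: bounded_ops_def)

lemma B_ops:
  "S \<otimes>\<^bsub>B\<^esub> T = (\<lambda>x\<in>carrier V. S (T x))"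
  "\<zero>\<^bsub>B\<^esub> = (\<lambda>x\<in>carrier V. \<zero>)"
  "S \<oplus>\<^bsub>B\<^esub> T = (\<lambda>x\<in>carrier V. S x \<oplus> T x)"
  "c \<odot>\<^bsub>B\<^esub> T = (\<lambda>x\<in>carrier V. c \<odot> T x)"
  "vnorm B T = (SUP x\<in>{x \<in> carrier V. vnorm V x \<le> 1}. vnorm V (T x))"
  by (simp_all add: bounded_ops_def)

lemma B_app:
  assumes "T \<in> carrier B"
  shows "x \<in> carrier V \<Longrightarrow> T x \<in> carrier V"
    and "\<lbrakk>x \<in> carrier V; y \<in> carrier V\<rbrakk> \<Longrightarrow> T (x \<oplus> y) = T x \<oplus> T y"
    and "x \<in> carrier V \<Longrightarrow> T (c \<odot> x) = c \<odot> T x"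
    and "T \<zero> = \<zero>"
proof -
  show *: "T (c \<odot> x) = c \<odot> T x" if "x \<in> carrier V" for c x
    using assms that by (simp add: carrier_B)
  show **: "T x \<in> carrier V" if "x \<in> carrier V" for x
    using assms that by (auto simp: carrier_B)
  show "T \<zero> = \<zero>" using *[of \<zero> 0] **[of \<zero>] by simp
qed (use assms in \<open>simp add: carrier_B\<close>)

lemma B_eqI:
  assumes "S \<in> carrier B" "T \<in> carrier B" "\<And>x. x \<in> carrier V \<Longrightarrow> S x = T x"
  shows "S = T"
  using assms unfolding carrier_B by (blast intro: PiE_ext)

lemma zero_in_ball: "\<zero> \<in> {x \<in> carrier V. vnorm V x \<le> 1}" by simp

lemma opnorm_bdd:
  assumes "T \<in> carrier B"
  shows "bdd_above ((\<lambda>x. vnorm V (T x)) ` {x \<in> carrier V. vnorm V x \<le> 1})"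
proof -
  obtain K where K: "\<And>x. x \<in> carrier V \<Longrightarrow> vnorm V (T x) \<le> K * vnorm V x"
    using assms unfolding carrier_B by blast
  have "vnorm V (T x) \<le> \<bar>K\<bar>" if "x \<in> carrier V" "vnorm V x \<le> 1" for x
  proof -
    have "K * vnorm V x \<le> \<bar>K\<bar> * vnorm V x"
      using vnorm_nonneg[OF that(1)] by (intro mult_right_mono) auto
    also have "\<dots> \<le> \<bar>K\<bar> * 1" using that by (intro mult_left_mono) auto
    finally show ?thesis using K[OF that(1)] by simp
  qed
  then show ?thesis by (auto intro!: bdd_aboveI2)
qed

lemma opnorm_upper:
  "\<lbrakk>T \<in> carrier B; x \<in> carrier V; vnorm V x \<le> 1\<rbrakk> \<Longrightarrow> vnorm V (T x) \<le> vnorm B T"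
  unfolding B_ops using opnorm_bdd by (intro cSUP_upper) auto

lemma opnorm_least:
  "(\<And>x. \<lbrakk>x \<in> carrier V; vnorm V x \<le> 1\<rbrakk> \<Longrightarrow> vnorm V (T x) \<le> K) \<Longrightarrow> vnorm B T \<le> K"
  unfolding B_ops using zero_in_ball by (intro cSUP_least) auto

lemma opnorm_nonneg: "T \<in> carrier B \<Longrightarrow> 0 \<le> vnorm B T"
  using opnorm_upper[of T \<zero>] by (simp add: B_app)

lemma opnorm_bound:
  assumes T: "T \<in> carrier B" and x: "x \<in> carrier V"
  shows "vnorm V (T x) \<le> vnorm B T * vnorm V x"
proof (cases "x = \<zero>")
  case True then show ?thesis using T by (simp add: B_app)
next
  case False
  then have p: "vnorm V x > 0" using vnorm_eq_0[OF x] vnorm_nonneg[OF x] by linarith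
  let ?c = "complex_of_real (1 / vnorm V x)"
  have "vnorm V (T (?c \<odot> x)) \<le> vnorm B T"
    using p x by (intro opnorm_upper T) (auto simp: vnorm_smult norm_divide)
  then show ?thesis
    using p by (simp add: B_app[OF T] x vnorm_smult norm_divide field_simps)
qed

lemma B_zero_closed: "\<zero>\<^bsub>B\<^esub> \<in> carrier B"
  by (auto simp: carrier_B B_ops(2) intro!: exI[of _ 0])

lemma B_add_closed:
  assumes S: "S \<in> carrier B" and T: "T \<in> carrier B"
  shows "S \<oplus>\<^bsub>B\<^esub> T \<in> carrier B"
proof -
  have "vnorm V ((S \<oplus>\<^bsub>B\<^esub> T) x) \<le> (vnorm B S + vnorm B T) * vnorm V x" if "x \<in> carrier V" for x
    using vnorm_triangle[of "S x" "T x"] opnorm_bound[OF S that] opnorm_bound[OF T that] that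
    by (simp add: B_app[OF S] B_app[OF T] B_ops(3) distrib_right)
  then show ?thesis
    unfolding carrier_B
    by (intro conjI) (auto simp: B_ops(3) B_app[OF S] B_app[OF T] M.a_ac smult_r_distr')
qed

lemma B_smult_closed:
  assumes T: "T \<in> carrier B"
  shows "c \<odot>\<^bsub>B\<^esub> T \<in> carrier B"
proof -
  have "vnorm V ((c \<odot>\<^bsub>B\<^esub> T) x) \<le> (cmod c * vnorm B T) * vnorm V x" if "x \<in> carrier V" for x
    using opnorm_bound[OF T that] that
    by (simp add: vnorm_smult B_app[OF T] B_ops(4) mult_left_mono mult.assoc)
  then show ?thesis
    unfolding carrier_B
    by (intro conjI exI[of _ "cmod c * vnorm B T"])
      (auto simp: B_ops(4) B_app[OF T] smult_r_distr' smult_assoc' mult_ac)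
qed

lemmas B_closed = B_zero_closed B_add_closed B_smult_closed

lemma opnorm_smult_le:
  assumes T: "T \<in> carrier B" shows "vnorm B (c \<odot>\<^bsub>B\<^esub> T) \<le> cmod c * vnorm B T"
  by (rule opnorm_least)
    (use opnorm_upper[OF T] in \<open>simp add: B_ops(4) vnorm_smult B_app[OF T] mult_left_mono\<close>)

lemma complex_normed_space_bounded_ops: "complex_normed_space B"
proof (rule complex_normed_spaceI)
  fix T assume T: "T \<in> carrier B"
  show "vnorm B T = 0 \<longleftrightarrow> T = \<zero>\<^bsub>B\<^esub>"
  proof
    assume z: "vnorm B T = 0"
    show "T = \<zero>\<^bsub>B\<^esub>"
    proof (rule B_eqI[OF T B_zero_closed])
      fix x assume x: "x \<in> carrier V"
      then have "vnorm V (T x) = 0"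
        using opnorm_bound[OF T x] z vnorm_nonneg[of "T x"] by (simp add: B_app[OF T])
      then show "T x = \<zero>\<^bsub>B\<^esub> x" using x vnorm_eq_0[of "T x"] by (simp add: B_ops(2) B_app[OF T])
    qed
  next
    assume "T = \<zero>\<^bsub>B\<^esub>"
    then have "vnorm B T \<le> 0" by (intro opnorm_least) (simp add: B_ops(2))
    then show "vnorm B T = 0" using opnorm_nonneg[OF T] by simp
  qed
  fix c
  show "vnorm B (c \<odot>\<^bsub>B\<^esub> T) = cmod c * vnorm B T"
  proof (cases "c = 0")
    case True
    then show ?thesis
      using opnorm_smult_le[OF T, of c] opnorm_nonneg[OF B_smult_closed[OF T, of c]] by simp
  next
    case False
    have "(1 / c) \<odot>\<^bsub>B\<^esub> (c \<odot>\<^bsub>B\<^esub> T) = T"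
      using False by (intro B_eqI B_closed T) (simp add: B_ops(4) smult_assoc' B_app[OF T])
    then have "vnorm B T \<le> cmod (1 / c) * vnorm B (c \<odot>\<^bsub>B\<^esub> T)"
      using opnorm_smult_le[OF B_smult_closed[OF T, of c], of "1 / c"] by simp
    then show ?thesis
      using False opnorm_smult_le[OF T, of c] by (simp add: norm_divide field_simps)
  qed
next
  fix S T assume S: "S \<in> carrier B" and T: "T \<in> carrier B"
  show "vnorm B (S \<oplus>\<^bsub>B\<^esub> T) \<le> vnorm B S + vnorm B T"
  proof (rule opnorm_least)
    fix x assume x: "x \<in> carrier V" "vnorm V x \<le> 1"
    show "vnorm V ((S \<oplus>\<^bsub>B\<^esub> T) x) \<le> vnorm B S + vnorm B T"
      using vnorm_triangle[of "S x" "T x"] opnorm_upper[OF S x] opnorm_upper[OF T x] x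
      by (simp add: B_ops(3) B_app[OF S] B_app[OF T])
  qed
next
  fix T assume T: "T \<in> carrier B"
  have "(-1) \<odot> T x \<oplus> T x = \<zero>" if "x \<in> carrier V" for x
    using M.l_neg[of "T x"] that by (simp add: a_inv_eq B_app[OF T])
  then show "(-1) \<odot>\<^bsub>B\<^esub> T \<oplus>\<^bsub>B\<^esub> T = \<zero>\<^bsub>B\<^esub>"
    by (intro B_eqI B_closed T) (simp_all add: B_ops(2-4))
next
  show "\<zero>\<^bsub>B\<^esub> \<in> carrier B"
    by (auto simp: carrier_B B_ops(2) intro!: exI[of _ 0])
next
  fix S T assume S: "S \<in> carrier B" and T: "T \<in> carrier B"
  show "S \<oplus>\<^bsub>B\<^esub> T = T \<oplus>\<^bsub>B\<^esub> S"
    by (intro B_eqI B_closed S T) (simp add: B_ops(3) B_app[OF S] B_app[OF T] M.a_comm)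
  fix c
  show "c \<odot>\<^bsub>B\<^esub> (S \<oplus>\<^bsub>B\<^esub> T) = c \<odot>\<^bsub>B\<^esub> S \<oplus>\<^bsub>B\<^esub> c \<odot>\<^bsub>B\<^esub> T"
    by (intro B_eqI B_closed S T) (simp add: B_ops(3,4) B_app[OF S] B_app[OF T] smult_r_distr')
  fix U assume U: "U \<in> carrier B"
  show "S \<oplus>\<^bsub>B\<^esub> T \<oplus>\<^bsub>B\<^esub> U = S \<oplus>\<^bsub>B\<^esub> (T \<oplus>\<^bsub>B\<^esub> U)"
    by (intro B_eqI B_closed S T U) (simp add: B_ops(3) B_app[OF S] B_app[OF T] B_app[OF U] M.a_assoc)
next
  fix T c d assume T: "T \<in> carrier B"
  show "\<zero>\<^bsub>B\<^esub> \<oplus>\<^bsub>B\<^esub> T = T"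
    by (intro B_eqI B_closed T) (simp add: B_ops(2,3) B_app[OF T])
  show "(c + d) \<odot>\<^bsub>B\<^esub> T = c \<odot>\<^bsub>B\<^esub> T \<oplus>\<^bsub>B\<^esub> d \<odot>\<^bsub>B\<^esub> T"
    by (intro B_eqI B_closed T) (simp add: B_ops(3,4) B_app[OF T] smult_l_distr')
  show "(c * d) \<odot>\<^bsub>B\<^esub> T = c \<odot>\<^bsub>B\<^esub> (d \<odot>\<^bsub>B\<^esub> T)"
    by (intro B_eqI B_closed T) (simp add: B_ops(4) B_app[OF T] smult_assoc')
  show "1 \<odot>\<^bsub>B\<^esub> T = T"
    by (intro B_eqI B_closed T) (simp add: B_ops(4) B_app[OF T])
qed (auto intro: B_closed opnorm_nonneg)

end

section \<open>Independence of the element types\<close>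

text \<open>Transport of the structure of a closed subspace \<open>Y\<close> of \<open>X\<close> along an injection \<open>f\<close>.\<close>

definition transport :: "('x \<Rightarrow> 'u) \<Rightarrow> 'x set \<Rightarrow> ('x, 'm) normed_module_scheme \<Rightarrow> 'u normed_module" where
  "transport f Y X = \<lparr>carrier = f ` Y, mult = undefined, one = undefined, zero = f \<zero>\<^bsub>X\<^esub>,
     add = (\<lambda>u v. f (inv_into Y f u \<oplus>\<^bsub>X\<^esub> inv_into Y f v)),
     smult = (\<lambda>c u. f (c \<odot>\<^bsub>X\<^esub> inv_into Y f u)),
     vnorm = (\<lambda>u. vnorm X (inv_into Y f u))\<rparr>"

locale transport_space = complex_banach_space X for X :: "('x, 'm) normed_module_scheme" (structure) +
  fixes Y :: "'x set" and f :: "'x \<Rightarrow> 'u"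
  assumes inj: "inj_on f Y" and sub: "Y \<subseteq> carrier X"
    and zero_Y: "\<zero> \<in> Y" and add_Y: "x \<in> Y \<Longrightarrow> y \<in> Y \<Longrightarrow> x \<oplus> y \<in> Y"
    and smult_Y: "x \<in> Y \<Longrightarrow> c \<odot> x \<in> Y"
    and closed_Y: "x \<in> carrier X \<Longrightarrow> (\<And>e. e > 0 \<Longrightarrow> \<exists>y\<in>Y. norm_dist X y x < e) \<Longrightarrow> x \<in> Y"
begin

abbreviation "T \<equiv> transport f Y X"

lemma carrier_T: "carrier T = f ` Y"
  and zero_T [simp]: "\<zero>\<^bsub>T\<^esub> = f \<zero>"
  by (simp_all add: transport_def)

lemma T_simps [simp]:
  "x \<in> Y \<Longrightarrow> y \<in> Y \<Longrightarrow> f x \<oplus>\<^bsub>T\<^esub> f y = f (x \<oplus> y)"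
  "x \<in> Y \<Longrightarrow> c \<odot>\<^bsub>T\<^esub> f x = f (c \<odot> x)"
  "x \<in> Y \<Longrightarrow> vnorm T (f x) = vnorm X x"
  by (simp_all add: transport_def inj)

lemma in_X [simp]: "x \<in> Y \<Longrightarrow> x \<in> carrier X"
  using sub by auto

lemma f_eq [simp]: "x \<in> Y \<Longrightarrow> y \<in> Y \<Longrightarrow> f x = f y \<longleftrightarrow> x = y"
  using inj by (auto simp: inj_on_def)

lemma T_normed: "complex_normed_space T"
proof (rule complex_normed_spaceI)
  fix x assume "x \<in> carrier T"
  then obtain x' where [simp]: "x' \<in> Y" "x = f x'" by (auto simp: carrier_T)
  have *: "(-1) \<odot> x' \<oplus> x' = \<zero>" using M.l_neg[of x'] by (simp add: a_inv_eq)
  show "(-1) \<odot>\<^bsub>T\<^esub> x \<oplus>\<^bsub>T\<^esub> x = \<zero>\<^bsub>T\<^esub>" by (simp add: smult_Y *)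
qed (auto simp: carrier_T zero_Y add_Y smult_Y M.a_comm M.a_assoc M.a_lcomm smult_l_distr' smult_r_distr'
       smult_assoc' vnorm_nonneg vnorm_eq_0 vnorm_triangle vnorm_smult)

interpretation T: complex_normed_space T by (rule T_normed)

lemma norm_dist_T [simp]:
  assumes "x \<in> Y" "y \<in> Y" shows "norm_dist T (f x) (f y) = norm_dist X x y"
proof -
  have "f x \<in> carrier T" "f y \<in> carrier T" using assms by (auto simp: carrier_T)
  then show ?thesis using assms by (simp add: T.norm_dist_eq norm_dist_eq smult_Y add_Y)
qed

lemma T_banach: "complex_banach_space T"
proof (intro complex_banach_space.intro T_normed complex_banach_space_axioms.intro)
  interpret MX: Metric_space "carrier X" "norm_dist X" by (rule Metric_space_norm_dist)
  interpret MT: Metric_space "carrier T" "norm_dist T" by (rule T.Metric_space_norm_dist)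
  show "MT.mcomplete"
    unfolding MT.mcomplete_def
  proof (intro allI impI)
    fix \<sigma> assume C: "MT.MCauchy \<sigma>"
    then have "range \<sigma> \<subseteq> f ` Y" unfolding MT.MCauchy_def by (simp only: carrier_T)
    then have "\<forall>n. \<exists>y\<in>Y. \<sigma> n = f y" by (auto simp: subset_iff image_iff)
    then obtain \<tau> where \<tau>: "\<And>n. \<tau> n \<in> Y" "\<And>n. \<sigma> n = f (\<tau> n)" by metis
    have d: "norm_dist T (\<sigma> n) (\<sigma> m) = norm_dist X (\<tau> n) (\<tau> m)" for n m
      by (simp only: \<tau> norm_dist_T)
    have "range \<tau> \<subseteq> carrier X" using \<tau>(1) by auto
    then have "MX.MCauchy \<tau>"
      using C unfolding MT.MCauchy_def MX.MCauchy_def d by blast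
    then obtain x where "limitin MX.mtopology \<tau> x sequentially"
      using complete unfolding MX.mcomplete_def by blast
    then have x: "x \<in> carrier X"
      "\<And>e. e > 0 \<Longrightarrow> \<forall>\<^sub>F n in sequentially. \<tau> n \<in> carrier X \<and> norm_dist X (\<tau> n) x < e"
      unfolding MX.limitin_metric by blast+
    have "x \<in> Y"
    proof (rule closed_Y[OF x(1)])
      fix e :: real assume "e > 0"
      from eventually_happens[OF x(2)[OF this]] \<tau>(1) show "\<exists>y\<in>Y. norm_dist X y x < e"
        by auto
    qed
    then have "\<sigma> n \<in> carrier T \<and> norm_dist T (\<sigma> n) (f x) < e
        \<longleftrightarrow> \<tau> n \<in> carrier X \<and> norm_dist X (\<tau> n) x < e" for n e
      using \<tau>(1)[of n] by (simp add: \<tau>(2) carrier_T)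
    moreover have "f x \<in> carrier T" using \<open>x \<in> Y\<close> by (simp add: carrier_T)
    ultimately have "limitin MT.mtopology \<sigma> (f x) sequentially"
      unfolding MT.limitin_metric using x(2) by simp
    then show "\<exists>x. limitin MT.mtopology \<sigma> x sequentially" by blast
  qed
qed

end

lemma transport_space_carrier:
  fixes X :: "('x, 'm) normed_module_scheme"
  assumes "complex_banach_space X" "inj_on f (carrier X)"
  shows "transport_space X (carrier X) f"
proof -
  interpret complex_banach_space X by fact
  show ?thesis by standard (use assms in auto)
qed


text \<open>
  The closed linear span \<open>Y\<close> of the range of a continuous bilinear map on \<open>'a\<close> embeds into
  \<open>nat \<Rightarrow> 'a\<close>: an element is determined by a sequence of finite sums that converges to it.
\<close>

definition pad :: "('a::zero \<times> 'a) list \<Rightarrow> nat \<Rightarrow> 'a \<times> 'a" where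
  "pad L j = (if j < length L then L ! j else (0, 0))"

primrec bilinear_sum :: "('x, 'm) normed_module_scheme \<Rightarrow> ('a \<Rightarrow> 'a \<Rightarrow> 'x) \<Rightarrow> ('a \<times> 'a) list \<Rightarrow> 'x" where
  "bilinear_sum X \<phi> [] = \<zero>\<^bsub>X\<^esub>"
| "bilinear_sum X \<phi> (p # L) = \<phi> (fst p) (snd p) \<oplus>\<^bsub>X\<^esub> bilinear_sum X \<phi> L"

locale bilinear_map = complex_banach_space X for X :: "('x, 'm) normed_module_scheme" (structure) +
  fixes \<phi> :: "'a::complex_banach_algebra \<Rightarrow> 'a \<Rightarrow> 'x"
  assumes bilin: "continuous_bilinear X \<phi>"
begin

abbreviation "bs \<equiv> bilinear_sum X \<phi>"

lemma phi_closed [simp]: "\<phi> a b \<in> carrier X"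
  using bilin by (simp add: continuous_bilinear_def)

lemma phi_smult: "\<phi> (c *\<^sub>C a) b = c \<odot> \<phi> a b"
  using bilin by (simp add: continuous_bilinear_def)

lemma phi_zero [simp]: "\<phi> 0 0 = \<zero>"
  using phi_smult[of 0 0 0] scaleC_of_real[of 0 "0::'a"] by simp

lemma bs_closed [simp]: "bs L \<in> carrier X"
  by (induction L) auto

lemma bs_append: "bs (L @ L') = bs L \<oplus> bs L'"
  by (induction L) (auto simp: M.a_assoc)

lemma bs_smult: "bs (map (\<lambda>p. (c *\<^sub>C fst p, snd p)) L) = c \<odot> bs L"
  by (induction L) (auto simp: smult_r_distr' phi_smult)

lemma bs_pad_zero: "(\<And>j. pad L j = (0, 0)) \<Longrightarrow> bs L = \<zero>"
proof (induction L)
  case (Cons p L)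
  have "pad L j = (0, 0)" for j using Cons.prems[of "Suc j"] by (auto simp: pad_def split: if_splits)
  then show ?case using Cons.IH Cons.prems[of 0] by (simp add: pad_def)
qed simp

lemma bs_pad: "(\<And>j. pad L j = pad L' j) \<Longrightarrow> bs L = bs L'"
proof (induction L arbitrary: L')
  case Nil
  have "bs L' = \<zero>" by (rule bs_pad_zero) (use Nil in \<open>simp add: pad_def\<close>)
  then show ?case by simp
next
  case (Cons p L)
  show ?case
  proof (cases L')
    case Nil
    have "bs (p # L) = \<zero>" by (rule bs_pad_zero) (use Cons.prems Nil in \<open>simp add: pad_def\<close>)
    then show ?thesis using Nil by simp
  next
    case L': (Cons p' L'')
    have "pad L j = pad L'' j" for j using Cons.prems[of "Suc j"] L' by (auto simp: pad_def split: if_splits)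
    moreover have "p = p'" using Cons.prems[of 0] L' by (simp add: pad_def)
    ultimately show ?thesis using Cons.IH[of L''] L' by simp
  qed
qed

definition Y :: "'x set" where
  "Y = {x \<in> carrier X. \<forall>e>0. \<exists>L. norm_dist X (bs L) x < e}"

lemma bs_in_Y: "bs L \<in> Y"
proof -
  interpret MX: Metric_space "carrier X" "norm_dist X" by (rule Metric_space_norm_dist)
  have "norm_dist X (bs L) (bs L) = 0" by simp
  then show ?thesis unfolding Y_def by (auto intro!: exI[of _ L])
qed

definition approx :: "'x \<Rightarrow> nat \<Rightarrow> ('a \<times> 'a) list" where
  "approx x n = (SOME L. norm_dist X (bs L) x < 1 / Suc n)"

lemma approx: "x \<in> Y \<Longrightarrow> norm_dist X (bs (approx x n)) x < 1 / Suc n"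
  unfolding approx_def by (rule someI_ex) (auto simp: Y_def)

definition enc :: "'x \<Rightarrow> nat \<Rightarrow> 'a" where
  "enc x k = (case prod_decode k of (n, m) \<Rightarrow>
     (if even m then fst else snd) (pad (approx x n) (m div 2)))"

lemma inj_enc: "inj_on enc Y"
proof (rule inj_onI)
  interpret MX: Metric_space "carrier X" "norm_dist X" by (rule Metric_space_norm_dist)
  fix x y assume xy: "x \<in> Y" "y \<in> Y" "enc x = enc y"
  have "bs (approx x n) = bs (approx y n)" for n
  proof (rule bs_pad)
    fix j
    have "fst (pad (approx x n) j) = fst (pad (approx y n) j)"
      using fun_cong[OF xy(3), of "prod_encode (n, 2 * j)"] by (simp add: enc_def)
    moreover have "snd (pad (approx x n) j) = snd (pad (approx y n) j)"
      using fun_cong[OF xy(3), of "prod_encode (n, Suc (2 * j))"] by (simp add: enc_def)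
    ultimately show "pad (approx x n) j = pad (approx y n) j" by (rule prod_eqI)
  qed
  then have "norm_dist X x y \<le> 1 / Suc n + 1 / Suc n" for n
    using approx[OF xy(1), of n] approx[OF xy(2), of n] xy
      MX.triangle[of x "bs (approx y n)" y] MX.commute[of x "bs (approx y n)"]
    by (simp add: Y_def)
  moreover have "(\<lambda>n. 1 / real (Suc n) + 1 / real (Suc n)) \<longlonglongrightarrow> 0 + 0"
    using LIMSEQ_inverse_real_of_nat by (intro tendsto_add) (simp_all add: inverse_eq_divide)
  ultimately have "norm_dist X x y \<le> 0 + 0"
    by (intro LIMSEQ_le_const) auto
  then show "x = y" using xy MX.nonneg[of x y] by (simp add: Y_def)
qed

lemma transport_Y: "transport_space X Y enc"
proof -
  interpret MX: Metric_space "carrier X" "norm_dist X" by (rule Metric_space_norm_dist)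
  show ?thesis
  proof
    show "inj_on enc Y" by (rule inj_enc)
    show "Y \<subseteq> carrier X" by (auto simp: Y_def)
    show "\<zero> \<in> Y" using bs_in_Y[of "[]"] by simp
  next
    fix x y assume xy: "x \<in> Y" "y \<in> Y"
    show "x \<oplus> y \<in> Y" unfolding Y_def
    proof (intro CollectI conjI allI impI)
      show "x \<oplus> y \<in> carrier X" using xy by (simp add: Y_def)
      fix e :: real assume "e > 0"
      then obtain L L' where L: "norm_dist X (bs L) x < e/2" "norm_dist X (bs L') y < e/2"
        using xy half_gt_zero[of e] unfolding Y_def by blast
      have c: "x \<in> carrier X" "y \<in> carrier X" using xy by (auto simp: Y_def)
      have "bs (L @ L') \<oplus> (-1) \<odot> (x \<oplus> y) = (bs L \<oplus> (-1) \<odot> x) \<oplus> (bs L' \<oplus> (-1) \<odot> y)"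
        using c by (simp add: bs_append smult_r_distr' M.a_ac)
      then have "norm_dist X (bs (L @ L')) (x \<oplus> y) < e"
        using L c vnorm_triangle[of "bs L \<oplus> (-1) \<odot> x" "bs L' \<oplus> (-1) \<odot> y"]
        by (simp add: norm_dist_eq)
      then show "\<exists>L. norm_dist X (bs L) (x \<oplus> y) < e" by blast
    qed
  next
    fix x c assume x: "x \<in> Y"
    then have [simp]: "x \<in> carrier X" by (simp add: Y_def)
    show "c \<odot> x \<in> Y" unfolding Y_def
    proof (intro CollectI conjI allI impI)
      fix e :: real assume e: "e > 0"
      have p: "cmod c + 1 > 0" using norm_ge_zero[of c] by linarith
      with e have "e / (cmod c + 1) > 0" by simp
      then obtain L where L: "norm_dist X (bs L) x < e / (cmod c + 1)"
        using x unfolding Y_def by blast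
      let ?L = "map (\<lambda>p. (c *\<^sub>C fst p, snd p)) L"
      have "bs ?L \<oplus> (-1) \<odot> (c \<odot> x) = c \<odot> (bs L \<oplus> (-1) \<odot> x)"
        by (simp add: bs_smult smult_r_distr' smult_assoc')
      then have "norm_dist X (bs ?L) (c \<odot> x) = cmod c * norm_dist X (bs L) x"
        by (simp add: norm_dist_eq vnorm_smult)
      also have "\<dots> \<le> (cmod c + 1) * norm_dist X (bs L) x"
        by (simp add: distrib_right)
      also have "\<dots> < e" using L p by (simp add: field_simps)
      finally show "\<exists>L. norm_dist X (bs L) (c \<odot> x) < e" by blast
    qed simp
  next
    fix x assume x: "x \<in> carrier X" "\<And>e. e > 0 \<Longrightarrow> \<exists>y\<in>Y. norm_dist X y x < e"
    show "x \<in> Y" unfolding Y_def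
    proof (intro CollectI conjI allI impI x(1))
      fix e :: real assume "e > 0"
      then have e: "e/2 > 0" by simp
      obtain y where y: "y \<in> Y" "norm_dist X y x < e/2" using x(2)[OF e] by blast
      obtain L where L: "norm_dist X (bs L) y < e/2" using y(1) e unfolding Y_def by blast
      have "norm_dist X (bs L) x < e"
        using MX.triangle[of "bs L" y x] x(1) y L by (simp add: Y_def)
      then show "\<exists>L. norm_dist X (bs L) x < e" by blast
    qed
  qed
qed

lemma property_B_imp:
  assumes "property_B TYPE('a)" "\<And>a b. a * b = 0 \<Longrightarrow> \<phi> a b = \<zero>"
  shows "\<phi> (a * b) c = \<phi> a (b * c)"
proof -
  interpret t: transport_space X Y enc by (rule transport_Y)
  interpret T: complex_banach_space t.T by (rule t.T_banach)
  have Y: "\<phi> a b \<in> Y" for a b using bs_in_Y[of "[(a, b)]"] by simp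
  have "continuous_bilinear t.T (\<lambda>a b. enc (\<phi> a b))"
    using bilin
    by (auto simp: continuous_bilinear_def Y t.carrier_T continuous_map_norm_topology
        T.continuous_map_norm_topology split_beta)
  moreover have "\<forall>a b. a * b = 0 \<longrightarrow> enc (\<phi> a b) = \<zero>\<^bsub>t.T\<^esub>"
    using assms(2) by simp
  ultimately have "enc (\<phi> (a * b) c) = enc (\<phi> a (b * c))"
    using assms(1) t.T_banach unfolding property_B_def property_B_on_def by blast
  then show ?thesis by (simp add: Y)
qed

end

theorem property_B_imp_property_B_on:
  assumes "property_B TYPE('a::complex_banach_algebra)"
  shows "property_B_on TYPE('a) TYPE('x)"
  unfolding property_B_on_def
proof (intro allI impI)
  fix X :: "'x normed_module" and \<phi> :: "'a \<Rightarrow> 'a \<Rightarrow> 'x" and a b c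
  assume "complex_banach_space X" "continuous_bilinear X \<phi>"
    and z: "\<forall>a b. a * b = 0 \<longrightarrow> \<phi> a b = \<zero>\<^bsub>X\<^esub>"
  then interpret bilinear_map X \<phi>
    by (simp add: bilinear_map_def bilinear_map_axioms_def)
  show "\<phi> (a * b) c = \<phi> a (b * c)"
    by (rule property_B_imp) (use assms z in auto)
qed



locale transport_rep = transport_space X "carrier X" f
  for X :: "('x, 'm) normed_module_scheme" (structure) and f :: "'x \<Rightarrow> 'u" +
  fixes \<pi> :: "'a::complex_banach_algebra \<Rightarrow> 'x \<Rightarrow> 'x"
  assumes rep: "continuous_representation X \<pi>"
begin

sublocale T: complex_banach_space T by (rule T_banach)
sublocale BX: complex_normed_space "bounded_ops X" by (rule complex_normed_space_bounded_ops)
sublocale BT: complex_normed_space "bounded_ops T" by (rule T.complex_normed_space_bounded_ops)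

definition tr :: "('x \<Rightarrow> 'x) \<Rightarrow> 'u \<Rightarrow> 'u" where
  "tr S = (\<lambda>u\<in>f ` carrier X. f (S (inv_into (carrier X) f u)))"

lemma tr_app [simp]: "x \<in> carrier X \<Longrightarrow> tr S (f x) = f (S x)"
  by (simp add: tr_def inj)

lemma tr_carrier:
  assumes S: "S \<in> carrier (bounded_ops X)"
  shows "tr S \<in> carrier (bounded_ops T)"
  unfolding T.carrier_B
proof (intro conjI exI[of _ "vnorm (bounded_ops X) S"])
  show "tr S \<in> carrier T \<rightarrow>\<^sub>E carrier T"
    by (auto simp: tr_def carrier_T inj B_app[OF S])
qed (auto simp: carrier_T B_app[OF S] opnorm_bound[OF S])

lemma tr_norm: "vnorm (bounded_ops T) (tr S) = vnorm (bounded_ops X) S"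
  if S: "S \<in> carrier (bounded_ops X)"
proof -
  have "{u \<in> carrier T. vnorm T u \<le> 1} = f ` {x \<in> carrier X. vnorm X x \<le> 1}"
    by (auto simp: carrier_T)
  moreover have "(\<lambda>u. vnorm T (tr S u)) ` f ` {x \<in> carrier X. vnorm X x \<le> 1}
      = (\<lambda>x. vnorm X (S x)) ` {x \<in> carrier X. vnorm X x \<le> 1}"
    unfolding image_image by (rule image_cong) (simp_all add: B_app[OF S])
  ultimately show ?thesis by (simp only: B_ops(5) T.B_ops(5))
qed

lemma tr_eqI:
  "\<lbrakk>P \<in> carrier (bounded_ops T); Q \<in> carrier (bounded_ops T);
    \<And>x. x \<in> carrier X \<Longrightarrow> P (f x) = Q (f x)\<rbrakk> \<Longrightarrow> P = Q"
  by (rule T.B_eqI) (auto simp: carrier_T)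

lemma f_in_T [simp]: "x \<in> carrier X \<Longrightarrow> f x \<in> carrier T"
  by (simp add: carrier_T)

lemma tr_add:
  assumes S: "S \<in> carrier (bounded_ops X)" and S': "S' \<in> carrier (bounded_ops X)"
  shows "tr (S \<oplus>\<^bsub>bounded_ops X\<^esub> S') = tr S \<oplus>\<^bsub>bounded_ops T\<^esub> tr S'"
  by (intro tr_eqI tr_carrier B_closed T.B_closed S S')
    (simp add: B_ops(3) T.B_ops(3) B_app[OF S] B_app[OF S'])

lemma tr_smult:
  assumes S: "S \<in> carrier (bounded_ops X)"
  shows "tr (c \<odot>\<^bsub>bounded_ops X\<^esub> S) = c \<odot>\<^bsub>bounded_ops T\<^esub> tr S"
  by (intro tr_eqI tr_carrier B_closed T.B_closed S)
    (simp add: B_ops(4) T.B_ops(4) B_app[OF S])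

lemma tr_mult:
  assumes S: "S \<in> carrier (bounded_ops X)" and S': "S' \<in> carrier (bounded_ops X)"
  shows "tr (S \<otimes>\<^bsub>bounded_ops X\<^esub> S') = tr S \<otimes>\<^bsub>bounded_ops T\<^esub> tr S'"
  by (rule ext) (auto simp: tr_def B_ops(1) T.B_ops(1) carrier_T inj B_app[OF S] B_app[OF S'])

lemma tr_zero_iff:
  assumes S: "S \<in> carrier (bounded_ops X)"
  shows "tr S = \<zero>\<^bsub>bounded_ops T\<^esub> \<longleftrightarrow> S = \<zero>\<^bsub>bounded_ops X\<^esub>"
  using BX.vnorm_eq_0[OF S] BT.vnorm_eq_0[OF tr_carrier[OF S]] tr_norm[OF S] by simp

lemma tr_dist:
  assumes S: "S \<in> carrier (bounded_ops X)" and S': "S' \<in> carrier (bounded_ops X)"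
  shows "norm_dist (bounded_ops T) (tr S) (tr S') = norm_dist (bounded_ops X) S S'"
  by (simp add: BX.norm_dist_eq BT.norm_dist_eq S S' tr_carrier BX.smult_closed'
      flip: tr_smult tr_add) (simp add: tr_norm S S')

lemma pi_carrier [simp]: "\<pi> a \<in> carrier (bounded_ops X)"
  using rep by (simp add: continuous_representation_def)

lemma rep_T: "continuous_representation T (\<lambda>a. tr (\<pi> a))"
  using rep
  by (simp add: continuous_representation_def tr_carrier tr_add tr_smult tr_mult
      BX.continuous_map_norm_topology BT.continuous_map_norm_topology tr_dist)

lemma kernel_T: "rep_kernel T (\<lambda>a. tr (\<pi> a)) = rep_kernel X \<pi>"
  by (simp add: rep_kernel_def tr_zero_iff)

lemma irreducible_T:
  assumes "irreducible_rep X \<pi>"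
  shows "irreducible_rep T (\<lambda>a. tr (\<pi> a))"
  unfolding irreducible_rep_def
proof (intro conjI allI impI)
  show "\<exists>a. tr (\<pi> a) \<noteq> \<zero>\<^bsub>bounded_ops T\<^esub>"
    using assms by (auto simp: irreducible_rep_def tr_zero_iff)
  fix Z assume Z: "submodule Z complex_ring T" and inv: "\<forall>a. tr (\<pi> a) ` Z \<subseteq> Z"
  note E = T.submoduleE[OF Z]
  define W where "W = {x \<in> carrier X. f x \<in> Z}"
  have ZW: "Z = f ` W" using E(1) by (auto simp: W_def carrier_T)
  have sm: "c \<odot> x \<in> W" if "x \<in> W" for c x
    using E(4)[of c "f x"] that by (simp add: W_def complex_ring_def)
  obtain z where "z \<in> W" using E(2) ZW by auto
  have "submodule W complex_ring X"
  proof (rule submoduleI)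
    show "\<zero> \<in> W" using sm[OF \<open>z \<in> W\<close>, of 0] \<open>z \<in> W\<close> by (simp add: W_def)
    fix x y assume "x \<in> W" "y \<in> W"
    then show "x \<oplus> y \<in> W" using E(5)[of "f x" "f y"] by (simp add: W_def)
  next
    fix x assume "x \<in> W" then show "\<ominus> x \<in> W"
      using sm[of x "-1"] by (simp add: W_def a_inv_eq)
  qed (auto simp: sm, auto simp: W_def)
  moreover have "\<pi> a ` W \<subseteq> W" for a
  proof
    fix y assume "y \<in> \<pi> a ` W"
    then obtain x where x: "x \<in> W" "y = \<pi> a x" by blast
    then have "tr (\<pi> a) (f x) \<in> Z" using inv ZW by blast
    then show "y \<in> W" using x by (simp add: W_def B_app[OF pi_carrier])
  qed
  ultimately have "W = {\<zero>} \<or> W = carrier X"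
    using assms by (simp add: irreducible_rep_def)
  then show "Z = {\<zero>\<^bsub>T\<^esub>} \<or> Z = carrier T"
    using ZW by (auto simp: carrier_T)
qed

lemma finsum_T:
  "finite I \<Longrightarrow> w \<in> I \<rightarrow> carrier X \<Longrightarrow> (\<Oplus>\<^bsub>T\<^esub> i \<in> I. f (w i)) = f (\<Oplus> i \<in> I. w i)"
  by (induction I rule: finite_induct) (auto simp: T.M.finsum_insert M.finsum_insert Pi_def)

lemma dim_T:
  assumes "dim_at_least n T" shows "dim_at_least n X"
proof -
  obtain v where v: "v \<in> {..<n} \<rightarrow> carrier T"
    "\<And>c. (\<Oplus>\<^bsub>T\<^esub> i \<in> {..<n}. c i \<odot>\<^bsub>T\<^esub> v i) = \<zero>\<^bsub>T\<^esub> \<Longrightarrow> \<forall>i<n. c i = 0"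
    using assms unfolding dim_at_least_def by blast
  have "\<forall>i. \<exists>x. i < n \<longrightarrow> x \<in> carrier X \<and> v i = f x"
    using v(1) by (auto simp: carrier_T Pi_def)
  then obtain w where w: "\<And>i. i < n \<Longrightarrow> w i \<in> carrier X \<and> v i = f (w i)" by metis
  show ?thesis unfolding dim_at_least_def
  proof (intro exI[of _ w] conjI allI impI)
    show "w \<in> {..<n} \<rightarrow> carrier X" using w by auto
    fix c i assume z: "(\<Oplus> i \<in> {..<n}. c i \<odot> w i) = \<zero>" and "i < n"
    have "(\<Oplus>\<^bsub>T\<^esub> i \<in> {..<n}. c i \<odot>\<^bsub>T\<^esub> v i) = (\<Oplus>\<^bsub>T\<^esub> i \<in> {..<n}. f (c i \<odot> w i))"
      using w by (intro T.M.finsum_cong') auto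
    also have "\<dots> = \<zero>\<^bsub>T\<^esub>" using w z by (subst finsum_T) auto
    finally show "c i = 0" using v(2) \<open>i < n\<close> by blast
  qed
qed

end

lemma irreducible_rep_inj:
  fixes X :: "('x, 'm) normed_module_scheme" and \<pi> :: "'a::complex_banach_algebra \<Rightarrow> 'x \<Rightarrow> 'x"
  assumes "complex_banach_space X" "continuous_representation X \<pi>" "irreducible_rep X \<pi>"
  shows "\<exists>f :: 'x \<Rightarrow> nat \<Rightarrow> 'a. inj_on f (carrier X)"
proof -
  interpret complex_banach_space X by fact
  have pi: "\<pi> a \<in> carrier B" "\<pi> (a + b) = \<pi> a \<oplus>\<^bsub>B\<^esub> \<pi> b" "\<pi> (c *\<^sub>C a) = c \<odot>\<^bsub>B\<^esub> \<pi> a"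
    "\<pi> (a * b) = \<pi> a \<otimes>\<^bsub>B\<^esub> \<pi> b" for a b c
    using assms(2) by (auto simp: continuous_representation_def)
  note app = B_app[OF pi(1)]
  obtain a where "\<pi> a \<noteq> \<zero>\<^bsub>B\<^esub>" using assms(3) by (auto simp: irreducible_rep_def)
  then obtain x where x: "x \<in> carrier X" "\<pi> a x \<noteq> \<zero>\<^bsub>B\<^esub> x"
    using B_eqI[OF pi(1)[of a] B_zero_closed] by blast
  define W where "W = range (\<lambda>a. \<pi> a x)"
  have sm: "c \<odot>\<^bsub>X\<^esub> y \<in> W" if y: "y \<in> W" for c y
  proof -
    obtain b where "y = \<pi> b x" using y by (auto simp: W_def)
    then have "c \<odot>\<^bsub>X\<^esub> y = \<pi> (c *\<^sub>C b) x" using x(1) by (simp add: pi(3) B_ops(4))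
    then show ?thesis by (simp add: W_def)
  qed
  have WX: "W \<subseteq> carrier X" using x(1) by (auto simp: W_def app)
  have "submodule W complex_ring X"
  proof (rule submoduleI)
    show "\<zero>\<^bsub>X\<^esub> \<in> W" using sm[of "\<pi> a x" 0] x(1) by (simp add: W_def app)
    fix y assume "y \<in> W" then show "\<ominus>\<^bsub>X\<^esub> y \<in> W"
      using sm[of y "-1"] WX by (auto simp: a_inv_eq)
  next
    fix y z assume "y \<in> W" "z \<in> W"
    then obtain b c where "y = \<pi> b x" "z = \<pi> c x" by (auto simp: W_def)
    then have "y \<oplus>\<^bsub>X\<^esub> z = \<pi> (b + c) x" using x(1) by (simp add: pi B_ops(3))
    then show "y \<oplus>\<^bsub>X\<^esub> z \<in> W" by (simp add: W_def)
  qed (use WX sm in auto)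
  moreover have "\<pi> b ` W \<subseteq> W" for b
  proof
    fix y assume "y \<in> \<pi> b ` W"
    then obtain c where "y = \<pi> b (\<pi> c x)" by (auto simp: W_def)
    then have "y = \<pi> (b * c) x" using x(1) by (simp add: pi B_ops(1))
    then show "y \<in> W" by (simp add: W_def)
  qed
  moreover have "W \<noteq> {\<zero>\<^bsub>X\<^esub>}" using x by (auto simp: W_def B_ops(2))
  ultimately have "carrier X = W" using assms(3) by (auto simp: irreducible_rep_def)
  then have "\<forall>y\<in>carrier X. \<exists>b. \<pi> b x = y" by (auto simp: W_def)
  from bchoice[OF this] obtain g where g: "\<And>y. y \<in> carrier X \<Longrightarrow> \<pi> (g y) x = y" by auto
  have "inj_on (\<lambda>y (n::nat). g y) (carrier X)"
  proof (rule inj_onI)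
    fix y z assume yz: "y \<in> carrier X" "z \<in> carrier X" "(\<lambda>n::nat. g y) = (\<lambda>n. g z)"
    from fun_cong[OF yz(3)] have eq: "g y = g z" .
    have "y = \<pi> (g y) x" by (rule g[OF yz(1), symmetric])
    also have "\<dots> = z" unfolding eq by (rule g[OF yz(2)])
    finally show "y = z" .
  qed
  then show ?thesis by (rule exI[of _ "\<lambda>y n. g y"])
qed

theorem property_beta_on_imp_property_beta:
  assumes "property_beta_on TYPE('a::complex_banach_algebra) TYPE('i) TYPE('x)"
  shows "property_beta TYPE('a)"
proof -
  obtain I :: "'i set" and X :: "'i \<Rightarrow> 'x normed_module" and \<pi> :: "'i \<Rightarrow> 'a \<Rightarrow> 'x \<Rightarrow> 'x"
    where H: "(\<forall>i\<in>I. complex_banach_space (X i) \<and> continuous_representation (X i) (\<pi> i)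
               \<and> irreducible_rep (X i) (\<pi> i)) \<and>
        (\<Inter>i\<in>I. rep_kernel (X i) (\<pi> i)) = jacobson_radical \<and>
        (\<forall>i\<in>I. dim_at_least 2 (X i) \<longrightarrow>
           (\<exists>q. q * q = 0 \<and> \<pi> i q \<noteq> \<zero>\<^bsub>bounded_ops (X i)\<^esub>))"
    using assms unfolding property_beta_on_def by (elim exE) (erule that)
  have I: "complex_banach_space (X i)" "continuous_representation (X i) (\<pi> i)"
      "irreducible_rep (X i) (\<pi> i)"
    and dim: "dim_at_least 2 (X i) \<Longrightarrow> \<exists>q. q * q = 0 \<and> \<pi> i q \<noteq> \<zero>\<^bsub>bounded_ops (X i)\<^esub>"
    if "i \<in> I" for i
    using H that by simp_all
  have ker: "(\<Inter>i\<in>I. rep_kernel (X i) (\<pi> i)) = jacobson_radical"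
    using H by simp
  have "\<forall>i. \<exists>f :: 'x \<Rightarrow> nat \<Rightarrow> 'a. i \<in> I \<longrightarrow> inj_on f (carrier (X i))"
    using irreducible_rep_inj[OF I] by simp
  from choice[OF this] obtain f :: "'i \<Rightarrow> 'x \<Rightarrow> nat \<Rightarrow> 'a"
    where f: "\<And>i. i \<in> I \<Longrightarrow> inj_on (f i) (carrier (X i))"
    by auto
  define k where "k i = rep_kernel (X i) (\<pi> i)" for i
  define s where "s = inv_into I k"
  have s: "s K \<in> I" "k (s K) = K" if "K \<in> k ` I" for K
    using that by (auto simp: s_def inv_into_into f_inv_into_f)
  define X' where "X' i = transport (f i) (carrier (X i)) (X i)" for i
  define \<pi>' where "\<pi>' i a = transport_rep.tr (X i) (f i) (\<pi> i a)" for i a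
  have tr: "transport_rep (X i) (f i) (\<pi> i)" if "i \<in> I" for i
    using transport_space_carrier[OF I(1) f] I(2) that
    by (simp add: transport_rep_def transport_rep_axioms_def)
  have *: "complex_banach_space (X' i)" "continuous_representation (X' i) (\<pi>' i)"
    "irreducible_rep (X' i) (\<pi>' i)" "rep_kernel (X' i) (\<pi>' i) = k i"
    "dim_at_least 2 (X' i) \<Longrightarrow> \<exists>q. q * q = 0 \<and> \<pi>' i q \<noteq> \<zero>\<^bsub>bounded_ops (X' i)\<^esub>"
    if "i \<in> I" for i
  proof -
    interpret transport_rep "X i" "f i" "\<pi> i" by (rule tr[OF that])
    have p: "\<pi>' i = (\<lambda>a. tr (\<pi> i a))" by (simp add: \<pi>'_def fun_eq_iff)
    show "complex_banach_space (X' i)" "continuous_representation (X' i) (\<pi>' i)"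
      "irreducible_rep (X' i) (\<pi>' i)" "rep_kernel (X' i) (\<pi>' i) = k i"
      unfolding X'_def p k_def using T_banach rep_T irreducible_T[OF I(3)[OF that]] kernel_T by auto
    assume "dim_at_least 2 (X' i)"
    then show "\<exists>q. q * q = 0 \<and> \<pi>' i q \<noteq> \<zero>\<^bsub>bounded_ops (X' i)\<^esub>"
      unfolding X'_def p tr_zero_iff[OF pi_carrier] by (intro dim[OF that] dim_T)
  qed
  have "(\<Inter>K\<in>k ` I. rep_kernel (X' (s K)) (\<pi>' (s K))) = (\<Inter>K\<in>k ` I. K)"
    using *(4)[OF s(1)] s(2) by simp
  also have "\<dots> = jacobson_radical" using ker by (simp add: k_def)
  finally show ?thesis
    unfolding property_beta_def property_beta_on_def
    using * s(1)
    by (intro exI[of _ "k ` I"] exI[of _ "\<lambda>K. X' (s K)"] exI[of _ "\<lambda>K. \<pi>' (s K)"] conjI ballI impI)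
      simp_all
qed

end

theory Submission
  imports Defs
begin

text \<open>
  The family witnessing the property \<open>\<beta>\<close> consists of the left multiplication representations on
  \<open>A/L\<close>, one for each maximal modular left ideal \<open>L\<close>. The kernel of such a representation is
  \<open>{a. a A \<subseteq> L}\<close>. It is contained in \<open>L\<close> because \<open>L\<close> is modular, and it contains the radical because
  it is the intersection of the transporters \<open>{x. x y \<in> L}\<close>, each of which is \<open>A\<close> or again a maximal
  modular left ideal (\<open>maximal_modular_transporter\<close>). Hence the kernels intersect in the radical
  (\<open>jacobson_radical_eq_kernels\<close>), and only the condition on square-zero elements needs the property
  \<open>B\<close>.

  Suppose that the representation on \<open>A/L\<close> annihilates every \<open>q\<close> with \<open>q\<^sup>2 = 0\<close>. If \<open>a b = 0\<close>, then
  \<open>(b c a)\<^sup>2 = 0\<close> for every \<open>c\<close>, so the bilinear map \<open>(a, b) \<mapsto> b c a y + L\<close> into \<open>A/L\<close> vanishes on pairs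
  with zero product. The property \<open>B\<close> then turns \<open>\<phi>(a b, d) = \<phi>(a, b d)\<close> into
  \<open>d c a b y - b d c a y \<in> L\<close>: modulo the kernel, every element commutes with all products of three
  elements (\<open>commutator_in\<close>). Since a right modular unit \<open>u\<close> can be replaced by \<open>u\<^sup>3\<close>, which is such a
  product, this forces \<open>L\<close> to be two-sided and \<open>A/L\<close> to be a commutative field (\<open>one_dimensional\<close>). By
  the theorem of Gelfand and Mazur, \<open>A/L\<close> is \<open>\<complex>\<close>, so its dimension is less than \<open>2\<close>.

  The theorem of Gelfand and Mazur is proved here without contour integrals and without continuous
  functionals. If \<open>a - z\<close> were invertible modulo \<open>L\<close> for all \<open>z\<close>, the norm of the resolvent would be a
  continuous function on \<open>\<complex>\<close> that tends to \<open>0\<close> at infinity and satisfies, up to a term of third order, a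
  mean value inequality over the four points \<open>z \<plusminus> t\<close>, \<open>z \<plusminus> \<i>t\<close>. Such a function vanishes
  (\<open>decaying_subharmonic_eq_0\<close>).
\<close>

section \<open>A maximum principle\<close>

text \<open>
  The factor \<open>1 + t\<^sup>3 f(z)\<^sup>3\<close> spoils the usual maximum principle only to third order in \<open>t\<close>. Adding
  \<open>\<delta> |z|\<^sup>2\<close>, whose mean over the four points exceeds its value at the centre by \<open>\<delta> t\<^sup>2\<close>, outweighs this
  error for small \<open>t\<close>, so the sum has no local maximum. If \<open>f w > 0\<close> and \<open>\<delta>\<close> is small, the decay of
  \<open>f\<close> forces the sum to have one.
\<close>

lemma decaying_subharmonic_eq_0:
  fixes f :: "complex \<Rightarrow> real"
  assumes nonneg: "\<And>z. 0 \<le> f z" and cont: "continuous_on UNIV f" and decay: "(f \<longlongrightarrow> 0) at_infinity"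
    and mean: "\<And>z t. t > 0 \<Longrightarrow> 4 * f z \<le> (1 + t ^ 3 * f z ^ 3) *
      (f (z + of_real t) + f (z - of_real t) + f (z + \<i> * of_real t) + f (z - \<i> * of_real t))"
  shows "f w = 0"
proof (rule ccontr)
  assume "f w \<noteq> 0"
  then have m: "f w > 0" using nonneg[of w] by simp
  have "\<forall>\<^sub>F z in at_infinity. f z < f w / 2"
    using order_tendstoD(2)[OF decay, of "f w / 2"] m by simp
  then obtain b where b: "\<And>z. b \<le> norm z \<Longrightarrow> f z < f w / 2"
    unfolding eventually_at_infinity by blast
  define \<rho> where "\<rho> = max (\<bar>b\<bar> + 1) (cmod w + 1)"
  have \<rho>: "\<rho> > 0" "b \<le> \<rho>" "cmod w < \<rho>" by (auto simp: \<rho>_def)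
  \<comment> \<open>On the circle of radius \<open>\<rho>\<close>, the added term is \<open>f w / 4\<close> and \<open>f\<close> is below \<open>f w / 2\<close>.\<close>
  define \<delta> where "\<delta> = f w / (4 * \<rho>\<^sup>2)"
  have \<delta>: "\<delta> > 0" using m \<rho> by (simp add: \<delta>_def)
  define h where "h z = f z + \<delta> * (cmod z)\<^sup>2" for z
  have "continuous_on (cball 0 \<rho>) h"
    unfolding h_def by (intro continuous_intros continuous_on_subset[OF cont]) auto
  then obtain z where z: "z \<in> cball 0 \<rho>" and zmax: "\<And>y. y \<in> cball 0 \<rho> \<Longrightarrow> h y \<le> h z"
    using continuous_attains_sup[of "cball 0 \<rho>" h] \<rho> by fastforce
  have "continuous_on (cball 0 \<rho>) f" by (rule continuous_on_subset[OF cont]) auto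
  then obtain v where v: "\<And>y. y \<in> cball 0 \<rho> \<Longrightarrow> f y \<le> f v"
    using continuous_attains_sup[of "cball 0 \<rho>" f] \<rho> by fastforce
  have "cmod z < \<rho>"
  proof (rule ccontr)
    assume "\<not> cmod z < \<rho>"
    then have n: "cmod z = \<rho>" using z by simp
    have "h w \<le> h z" using zmax \<rho> by simp
    moreover have "f w \<le> h w" using \<delta> by (simp add: h_def)
    moreover have "h z < f w / 2 + f w / 4"
      using b[of z] \<rho> n by (simp add: h_def \<delta>_def)
    ultimately show False using m by linarith
  qed
  \<comment> \<open>The whole cross around \<open>z\<close> lies in the disc, and \<open>t f(v)\<^sup>4 < \<delta>\<close>.\<close>
  define t where "t = min (\<rho> - cmod z) (\<delta> / (2 * (f v ^ 4 + 1)))"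
  have fv: "f v ^ 4 \<ge> 0" by simp
  have t: "t > 0" "cmod z + t \<le> \<rho>" using \<open>cmod z < \<rho>\<close> \<delta> fv by (auto simp: t_def add_nonneg_pos)
  have tv: "t * f v ^ 4 < \<delta>"
  proof -
    have "t * (f v ^ 4 + 1) \<le> \<delta> / (2 * (f v ^ 4 + 1)) * (f v ^ 4 + 1)"
      using fv by (intro mult_right_mono) (auto simp: t_def)
    also have "\<dots> = \<delta> / 2" using fv by (simp add: field_simps add_nonneg_eq_0_iff)
    finally show ?thesis using t \<delta> by (simp add: distrib_left)
  qed
  define S where "S g = g (z + of_real t) + g (z - of_real t) + g (z + \<i> * of_real t) + g (z - \<i> * of_real t)"
    for g :: "complex \<Rightarrow> real"
  have in_ball: "z + of_real t \<in> cball 0 \<rho>" "z - of_real t \<in> cball 0 \<rho>"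
    "z + \<i> * of_real t \<in> cball 0 \<rho>" "z - \<i> * of_real t \<in> cball 0 \<rho>"
    using t norm_triangle_ineq[of z "of_real t"] norm_triangle_ineq4[of z "of_real t"]
      norm_triangle_ineq[of z "\<i> * of_real t"] norm_triangle_ineq4[of z "\<i> * of_real t"]
    by (auto simp: norm_mult)
  have "S h \<le> 4 * h z"
    unfolding S_def using zmax[OF in_ball(1)] zmax[OF in_ball(2)] zmax[OF in_ball(3)] zmax[OF in_ball(4)]
    by linarith
  moreover have "S h = S f + 4 * \<delta> * ((cmod z)\<^sup>2 + t\<^sup>2)"
    unfolding S_def h_def cmod_power2 by (simp add: power2_eq_square algebra_simps)
  moreover have "4 * f z \<le> S f + 4 * (t ^ 3 * f v ^ 4)"
  proof -
    have "S f \<le> 4 * f v" unfolding S_def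
      using v[OF in_ball(1)] v[OF in_ball(2)] v[OF in_ball(3)] v[OF in_ball(4)] by linarith
    moreover have "0 \<le> S f" by (simp add: S_def nonneg)
    moreover have "f z ^ 3 \<le> f v ^ 3" by (intro power_mono v z nonneg)
    ultimately have "f z ^ 3 * S f \<le> f v ^ 3 * (4 * f v)" by (intro mult_mono) (auto simp: nonneg)
    then have "t ^ 3 * (f z ^ 3 * S f) \<le> t ^ 3 * (f v ^ 3 * (4 * f v))" using t by (intro mult_left_mono) auto
    then show ?thesis using mean[OF t(1), of z]
      unfolding S_def[of f, symmetric] by (simp add: algebra_simps power4_eq_xxxx power3_eq_cube)
  qed
  ultimately have "4 * (\<delta> * t\<^sup>2) \<le> 4 * (t ^ 3 * f v ^ 4)"
    by (simp add: h_def algebra_simps)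
  also have "t ^ 3 * f v ^ 4 = (t * f v ^ 4) * t\<^sup>2" by (simp add: power3_eq_cube power2_eq_square)
  also have "4 * \<dots> < 4 * (\<delta> * t\<^sup>2)" using tv t by simp
  finally show False by simp
qed

section \<open>Quotients by closed left ideals\<close>

lemma scaleC_0_left [simp]: "0 *\<^sub>C x = (0 :: 'a::complex_banach_algebra)"
  using scaleC_of_real[of 0 x] by simp

lemma scaleC_1 [simp]: "1 *\<^sub>C x = (x :: 'a::complex_banach_algebra)"
  using scaleC_of_real[of 1 x] by simp

lemma scaleC_minus_1: "(-1) *\<^sub>C x = - (x :: 'a::complex_banach_algebra)"
  using scaleC_of_real[of "-1" x] by simp

lemma scaleC_minus_left: "(- c) *\<^sub>C x = - (c *\<^sub>C (x :: 'a::complex_banach_algebra))"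
  using scaleC_add_left[of c "-c" x] by (simp add: eq_neg_iff_add_eq_0 add.commute)

lemma scaleC_minus_right: "c *\<^sub>C (- x) = - (c *\<^sub>C (x :: 'a::complex_banach_algebra))"
  using scaleC_scaleC[of c "-1" x] by (simp add: scaleC_minus_1 scaleC_minus_left)

lemma scaleC_diff_right: "c *\<^sub>C (x - y) = c *\<^sub>C x - c *\<^sub>C (y :: 'a::complex_banach_algebra)"
  using scaleC_add_right[of c x "-y"] by (simp add: scaleC_minus_right)

lemma scaleC_diff_left: "(c - d) *\<^sub>C x = c *\<^sub>C x - d *\<^sub>C (x :: 'a::complex_banach_algebra)"
  using scaleC_add_left[of c "-d" x] by (simp add: scaleC_minus_left)

lemmas scaleC_simps = scaleC_add_right scaleC_add_left scaleC_diff_right scaleC_diff_left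
  scaleC_minus_left scaleC_minus_right scaleC_scaleC mult_scaleC_left mult_scaleC_right

text \<open>
  The coset \<open>x + L\<close> is encoded by a representative that depends only on the coset. Thus \<open>A/L\<close> becomes a
  structure on a subset of \<open>A\<close>.
\<close>

definition coset_rep :: "'a::complex_banach_algebra set \<Rightarrow> 'a \<Rightarrow> 'a" where
  "coset_rep L x = (SOME y. y - x \<in> L)"

definition quotient_space :: "'a::complex_banach_algebra set \<Rightarrow> 'a normed_module" where
  "quotient_space L = \<lparr>carrier = range (coset_rep L), mult = undefined, one = undefined,
     zero = coset_rep L 0, add = (\<lambda>x y. coset_rep L (x + y)), smult = (\<lambda>c x. coset_rep L (c *\<^sub>C x)),
     vnorm = (\<lambda>x. infdist x L)\<rparr>"

definition quotient_rep :: "'a::complex_banach_algebra set \<Rightarrow> 'a \<Rightarrow> 'a \<Rightarrow> 'a" where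
  "quotient_rep L a = (\<lambda>x\<in>carrier (quotient_space L). coset_rep L (a * x))"

locale left_ideal_quotient =
  fixes L :: "'a::complex_banach_algebra set"
  assumes ideal: "left_ideal L"
begin

lemma zero_in [simp]: "0 \<in> L"
  and add_in: "x \<in> L \<Longrightarrow> y \<in> L \<Longrightarrow> x + y \<in> L"
  and scaleC_in: "x \<in> L \<Longrightarrow> c *\<^sub>C x \<in> L"
  and mult_in: "x \<in> L \<Longrightarrow> a * x \<in> L"
  using ideal unfolding left_ideal_def by auto

lemma minus_in: "x \<in> L \<Longrightarrow> - x \<in> L"
  using scaleC_in[of x "-1"] by (simp add: scaleC_minus_1)

lemma diff_in: "x \<in> L \<Longrightarrow> y \<in> L \<Longrightarrow> x - y \<in> L"
  using add_in[of x "-y"] minus_in[of y] by simp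

lemma diff_sym: "x - y \<in> L \<Longrightarrow> y - x \<in> L"
  using minus_in[of "x - y"] by simp

lemma diff_trans: "x - y \<in> L \<Longrightarrow> y - z \<in> L \<Longrightarrow> x - z \<in> L"
  using add_in[of "x - y" "y - z"] by simp

lemma in_cong: "x - y \<in> L \<Longrightarrow> x \<in> L \<longleftrightarrow> y \<in> L"
  using add_in[of "x - y" y] diff_in[of x "x - y"] by auto

abbreviation r :: "'a \<Rightarrow> 'a" where "r \<equiv> coset_rep L"
abbreviation p :: "'a \<Rightarrow> real" where "p x \<equiv> infdist x L"
abbreviation Q :: "'a normed_module" where "Q \<equiv> quotient_space L"

lemma r_diff: "r x - x \<in> L"
  unfolding coset_rep_def by (rule someI[of _ x]) simp

lemma r_eq_iff: "r x = r y \<longleftrightarrow> x - y \<in> L"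
proof
  assume "r x = r y"
  then show "x - y \<in> L" using r_diff[of x] r_diff[of y] diff_in[of "r y - y" "r x - x"] by simp
next
  assume xy: "x - y \<in> L"
  have "z - x \<in> L \<longleftrightarrow> z - y \<in> L" for z
    using diff_trans[of z x y] diff_trans[of z y x] xy diff_sym[OF xy] by blast
  then show "r x = r y" by (simp add: coset_rep_def)
qed

lemma r_r [simp]: "r (r x) = r x"
  by (simp add: r_eq_iff r_diff)

lemma r_add_left [simp]: "r (r x + y) = r (x + y)"
  and r_add_right [simp]: "r (y + r x) = r (y + x)"
  and r_scaleC [simp]: "r (c *\<^sub>C r x) = r (c *\<^sub>C x)"
  and r_mult [simp]: "r (a * r x) = r (a * x)"
  using r_diff[of x] scaleC_in[OF r_diff, of c x] mult_in[OF r_diff, of a x]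
  by (simp_all add: r_eq_iff scaleC_diff_right right_diff_distrib)

lemma r_in_iff [simp]: "r x \<in> L \<longleftrightarrow> x \<in> L"
  by (rule in_cong[OF r_diff])

lemma r_eq_0_iff: "r x = r 0 \<longleftrightarrow> x \<in> L"
  by (simp add: r_eq_iff)

lemma p_le_norm: "p x \<le> norm x"
  using infdist_le[OF zero_in, of x] by simp

lemma p_less_iff: "p x < e \<longleftrightarrow> (\<exists>l\<in>L. norm (x - l) < e)"
proof
  assume "p x < e"
  moreover have "bdd_below ((\<lambda>l. dist x l) ` L)" by (intro bdd_belowI[of _ 0]) auto
  moreover have "L \<noteq> {}" using zero_in by blast
  ultimately show "\<exists>l\<in>L. norm (x - l) < e"
    using cInf_less_iff[of "(\<lambda>l. dist x l) ` L" e]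
    by (auto simp: infdist_def dist_norm split: if_splits)
next
  assume "\<exists>l\<in>L. norm (x - l) < e"
  then obtain l where "l \<in> L" "norm (x - l) < e" by auto
  then show "p x < e" using infdist_le[of l L x] by (simp add: dist_norm)
qed

lemma p_leI: "(\<And>e. p y < e \<Longrightarrow> p x < e) \<Longrightarrow> p x \<le> p y"
  using less_irrefl linorder_not_le by blast

lemma p_cong: assumes xy: "x - y \<in> L" shows "p x = p y"
proof -
  have *: "p x \<le> p y" if "x - y \<in> L" for x y
  proof (rule p_leI)
    fix e assume "p y < e"
    then obtain l where l: "l \<in> L" "norm (y - l) < e" by (auto simp: p_less_iff)
    then show "p x < e" unfolding p_less_iff
      by (intro bexI[of _ "x - y + l"] add_in that) (auto simp: algebra_simps)
  qed
  show ?thesis using *[OF xy] *[OF diff_sym[OF xy]] by simp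
qed

lemma p_r [simp]: "p (r x) = p x"
  by (rule p_cong[OF r_diff])

lemma p_add: "p (x + y) \<le> p x + p y"
proof (rule field_le_epsilon)
  fix e :: real assume e: "e > 0"
  then have "p x < p x + e/2" "p y < p y + e/2" by auto
  then obtain l m where lm: "l \<in> L" "m \<in> L" "norm (x - l) < p x + e/2" "norm (y - m) < p y + e/2"
    unfolding p_less_iff by blast
  have "norm (x + y - (l + m)) < p x + p y + e"
    using norm_triangle_ineq[of "x - l" "y - m"] lm by (simp add: algebra_simps)
  then have "p (x + y) < p x + p y + e" unfolding p_less_iff using lm add_in by blast
  then show "p (x + y) \<le> p x + p y + e" by simp
qed

lemma p_scaleC_le: "p (c *\<^sub>C x) \<le> cmod c * p x"
proof (rule field_le_epsilon)
  fix e :: real assume e: "e > 0"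
  define d where "d = e / (cmod c + 1)"
  have c: "cmod c + 1 > 0" using norm_ge_zero[of c] by linarith
  have d: "d > 0" using e c by (simp add: d_def)
  then have "p x < p x + d" by simp
  then obtain l where l: "l \<in> L" "norm (x - l) < p x + d"
    unfolding p_less_iff by blast
  have "p (c *\<^sub>C x) \<le> norm (c *\<^sub>C x - c *\<^sub>C l)"
    using infdist_le[OF scaleC_in[OF l(1)], of "c *\<^sub>C x" c] by (simp add: dist_norm)
  also have "\<dots> = cmod c * norm (x - l)" by (simp add: norm_scaleC flip: scaleC_diff_right)
  also have "\<dots> \<le> cmod c * (p x + d)" using l by (intro mult_left_mono) auto
  also have "cmod c * d \<le> (cmod c + 1) * d" using d by simp
  then have "cmod c * (p x + d) \<le> cmod c * p x + e" using c by (simp add: d_def distrib_left)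
  finally show "p (c *\<^sub>C x) \<le> cmod c * p x + e" .
qed

lemma p_scaleC: "p (c *\<^sub>C x) = cmod c * p x"
proof (cases "c = 0")
  case False
  have "cmod c * p ((1/c) *\<^sub>C c *\<^sub>C x) \<le> cmod c * (cmod (1/c) * p (c *\<^sub>C x))"
    by (intro mult_left_mono p_scaleC_le) auto
  also have "\<dots> = p (c *\<^sub>C x)" using False by (simp add: norm_divide)
  finally have "cmod c * p x \<le> p (c *\<^sub>C x)" using False by (simp add: scaleC_scaleC)
  then show ?thesis using p_scaleC_le[of c x] by simp
qed simp

lemma p_minus: "p (- x) = p x"
  using p_scaleC[of "-1" x] by (simp add: scaleC_minus_1)

lemma p_diff_sym: "p (x - y) = p (y - x)"
  using p_minus[of "x - y"] by simp

lemma p_mult_le: "p (a * x) \<le> norm a * p x"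
proof (rule field_le_epsilon)
  fix e :: real assume e: "e > 0"
  define d where "d = e / (norm a + 1)"
  have c: "norm a + 1 > 0" using norm_ge_zero[of a] by linarith
  have d: "d > 0" using e c by (simp add: d_def)
  then have "p x < p x + d" by simp
  then obtain l where l: "l \<in> L" "norm (x - l) < p x + d"
    unfolding p_less_iff by blast
  have "p (a * x) \<le> norm (a * x - a * l)"
    using infdist_le[OF mult_in[OF l(1)], of "a * x" a] by (simp add: dist_norm)
  also have "\<dots> \<le> norm a * norm (x - l)"
    using norm_mult_ineq[of a "x - l"] by (simp add: right_diff_distrib)
  also have "\<dots> \<le> norm a * (p x + d)" using l by (intro mult_left_mono) auto
  also have "norm a * d \<le> (norm a + 1) * d" using d by simp
  then have "norm a * (p x + d) \<le> norm a * p x + e" using c by (simp add: d_def distrib_left)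
  finally show "p (a * x) \<le> norm a * p x + e" .
qed

lemma Q_simps [simp]:
  "carrier Q = range r" "\<zero>\<^bsub>Q\<^esub> = r 0" "x \<oplus>\<^bsub>Q\<^esub> y = r (x + y)" "c \<odot>\<^bsub>Q\<^esub> x = r (c *\<^sub>C x)" "vnorm Q x = p x"
  by (simp_all add: quotient_space_def)

end

locale closed_left_ideal = left_ideal_quotient +
  assumes closed: "closed L"
begin

lemma p_eq_0_iff: "p x = 0 \<longleftrightarrow> x \<in> L"
  using in_closed_iff_infdist_zero[OF closed, of x] zero_in by blast

lemma Q_normed: "complex_normed_space Q"
  by (rule complex_normed_spaceI)
    (auto simp: add_ac scaleC_simps p_eq_0_iff r_eq_0_iff p_add p_scaleC scaleC_minus_1 infdist_nonneg)

sublocale Q: complex_normed_space Q by (rule Q_normed)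

lemma dist_Q [simp]: "norm_dist Q (r x) (r y) = p (x - y)"
proof -
  have "norm_dist Q (r x) (r y) = p (x + (-1) *\<^sub>C y)"
    by (subst Q.norm_dist_eq) simp_all
  then show ?thesis by (simp add: scaleC_minus_1)
qed

text \<open>
  A Cauchy sequence in \<open>A/L\<close> has a subsequence whose successive differences have quotient norm below
  \<open>2\<^sup>-\<^sup>k\<close>. These differences lift to elements \<open>d\<^sub>k\<close> of \<open>A\<close> with the same bound on the norm, and the
  series of the \<open>d\<^sub>k\<close> converges in \<open>A\<close> to a lift of the limit.
\<close>

lemma Q_banach: "complex_banach_space Q"
proof (intro complex_banach_space.intro Q_normed complex_banach_space_axioms.intro)
  interpret M: Metric_space "carrier Q" "norm_dist Q" by (rule Q.Metric_space_norm_dist)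
  show "M.mcomplete"
    unfolding M.mcomplete_def
  proof (intro allI impI)
    fix \<sigma> assume C: "M.MCauchy \<sigma>"
    then have "range \<sigma> \<subseteq> range r" unfolding M.MCauchy_def by simp
    then have "\<forall>n. \<exists>x. \<sigma> n = r x" by auto
    then obtain \<tau> where \<tau>: "\<And>n. \<sigma> n = r (\<tau> n)" by metis
    have "\<exists>N. \<forall>n n'. N \<le> n \<longrightarrow> N \<le> n' \<longrightarrow> p (\<tau> n - \<tau> n') < e" if "e > 0" for e
      using C that unfolding M.MCauchy_def \<tau> dist_Q by blast
    then have "\<exists>N. \<forall>n\<ge>N. \<forall>n'\<ge>N. p (\<tau> n - \<tau> n') < (1/2)^k" for k
      by (metis zero_less_divide_1_iff zero_less_numeral zero_less_power)
    then obtain N where N: "\<And>k n n'. N k \<le> n \<Longrightarrow> N k \<le> n' \<Longrightarrow> p (\<tau> n - \<tau> n') < (1/2)^k"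
      by metis
    define s where "s k = Max (N ` {..k})" for k
    have sN: "N k \<le> s j" if "k \<le> j" for k j using that by (simp add: s_def)
    have "\<exists>l\<in>L. norm (\<tau> (s (Suc k)) - \<tau> (s k) - l) < (1/2)^k" for k
      using N[of k "s (Suc k)" "s k"] sN by (simp flip: p_less_iff)
    then obtain l where l: "\<And>k. l k \<in> L" "\<And>k. norm (\<tau> (s (Suc k)) - \<tau> (s k) - l k) < (1/2)^k"
      by metis
    define d where "d k = \<tau> (s (Suc k)) - \<tau> (s k) - l k" for k
    have "summable d"
    proof (rule summable_comparison_test')
      show "summable (\<lambda>k. (1/2::real)^k)" by (rule summable_geometric) simp
      show "norm (d k) \<le> (1/2)^k" if "k \<ge> 0" for k using l(2)[of k] by (simp add: d_def)
    qed
    then have lim: "(\<lambda>K. \<Sum>k<K. d k) \<longlonglongrightarrow> suminf d" by (simp add: summable_LIMSEQ)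
    have partial: "\<tau> (s K) - (\<tau> (s 0) + (\<Sum>k<K. d k)) \<in> L" for K
    proof (induction K)
      case (Suc K)
      have "\<tau> (s (Suc K)) - (\<tau> (s 0) + (\<Sum>k<Suc K. d k)) = \<tau> (s K) - (\<tau> (s 0) + (\<Sum>k<K. d k)) + l K"
        by (simp add: d_def)
      then show ?case using add_in[OF Suc l(1)[of K]] by (simp only:)
    qed simp
    define x where "x = \<tau> (s 0) + suminf d"
    have sub: "p (\<tau> (s K) - x) \<le> norm ((\<Sum>k<K. d k) - suminf d)" for K
    proof -
      have "p (\<tau> (s K) - x) = p ((\<Sum>k<K. d k) - suminf d)"
        by (rule p_cong) (use partial[of K] in \<open>simp add: x_def algebra_simps\<close>)
      then show ?thesis using p_le_norm by simp
    qed
    have "limitin M.mtopology \<sigma> (r x) sequentially"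
      unfolding M.limitin_metric
    proof (intro conjI allI impI)
      fix e :: real assume e: "e > 0"
      have "\<forall>\<^sub>F K in sequentially. norm ((\<Sum>k<K. d k) - suminf d) < e/2"
        using lim e by (auto simp: tendsto_iff dist_norm dest!: spec[of _ "e/2"])
      moreover have "\<forall>\<^sub>F K in sequentially. (1/2::real)^K < e/2"
        using LIMSEQ_power_zero[of "1/2::real"] e by (intro order_tendstoD(2)[where y=0]) auto
      ultimately have "\<forall>\<^sub>F K in sequentially. norm ((\<Sum>k<K. d k) - suminf d) < e/2 \<and> (1/2::real)^K < e/2"
        by (rule eventually_conj)
      from eventually_happens[OF this] obtain K where
        K: "norm ((\<Sum>k<K. d k) - suminf d) < e/2" "(1/2::real)^K < e/2"
        by (auto simp: trivial_limit_sequentially)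
      have "p (\<tau> n - x) < e" if "n \<ge> N K" for n
        using p_add[of "\<tau> n - \<tau> (s K)" "\<tau> (s K) - x"] N[OF that sN[of K K]] K sub[of K] by simp
      then show "\<forall>\<^sub>F n in sequentially. \<sigma> n \<in> carrier Q \<and> norm_dist Q (\<sigma> n) (r x) < e"
        by (auto simp: \<tau> eventually_sequentially)
    qed simp
    then show "\<exists>x. limitin M.mtopology \<sigma> x sequentially" by blast
  qed
qed

abbreviation \<pi> :: "'a \<Rightarrow> 'a \<Rightarrow> 'a" where "\<pi> \<equiv> quotient_rep L"

lemma \<pi>_app [simp]: "\<pi> a (r x) = r (a * x)"
  by (simp add: quotient_rep_def)

lemma \<pi>_closed: "\<pi> a \<in> carrier (bounded_ops Q)"
  unfolding Q.carrier_B
proof (intro conjI exI[of _ "norm a"])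
  show "\<pi> a \<in> carrier Q \<rightarrow>\<^sub>E carrier Q" by (auto simp: quotient_rep_def)
  have "r (a * r x + a * r y) = r (a * x + a * y)" "r (c *\<^sub>C (a * r x)) = r (c *\<^sub>C (a * x))" for c x y
    by (metis r_add_left r_add_right r_mult, metis r_scaleC r_mult)
  then show "\<forall>x\<in>carrier Q. \<forall>y\<in>carrier Q. \<pi> a (x \<oplus>\<^bsub>Q\<^esub> y) = \<pi> a x \<oplus>\<^bsub>Q\<^esub> \<pi> a y"
    "\<forall>c. \<forall>x\<in>carrier Q. \<pi> a (c \<odot>\<^bsub>Q\<^esub> x) = c \<odot>\<^bsub>Q\<^esub> \<pi> a x"
    by (auto simp: distrib_left mult_scaleC_right)
qed (auto simp: p_mult_le)

lemma \<pi>_eqI: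
  assumes "S \<in> carrier (bounded_ops Q)" "T \<in> carrier (bounded_ops Q)" "\<And>x. S (r x) = T (r x)"
  shows "S = T"
  by (rule Q.B_eqI[OF assms(1,2)]) (auto simp: assms(3))

lemma kernel_iff: "\<pi> a = \<zero>\<^bsub>bounded_ops Q\<^esub> \<longleftrightarrow> (\<forall>x. a * x \<in> L)"
proof
  assume "\<pi> a = \<zero>\<^bsub>bounded_ops Q\<^esub>"
  then have "\<pi> a (r x) = r 0" for x by (simp add: Q.B_ops(2) del: \<pi>_app)
  then show "\<forall>x. a * x \<in> L" by (simp add: r_eq_0_iff)
next
  assume "\<forall>x. a * x \<in> L"
  then show "\<pi> a = \<zero>\<^bsub>bounded_ops Q\<^esub>"
    by (intro \<pi>_eqI \<pi>_closed Q.B_zero_closed) (simp add: Q.B_ops(2) r_eq_0_iff)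
qed

lemma \<pi>_add: "\<pi> (a + b) = \<pi> a \<oplus>\<^bsub>bounded_ops Q\<^esub> \<pi> b"
  by (intro \<pi>_eqI \<pi>_closed Q.B_closed) (simp add: Q.B_ops(3) distrib_right)

lemma \<pi>_scaleC: "\<pi> (c *\<^sub>C a) = c \<odot>\<^bsub>bounded_ops Q\<^esub> \<pi> a"
  by (intro \<pi>_eqI \<pi>_closed Q.B_closed) (simp add: Q.B_ops(4) mult_scaleC_left)

lemma \<pi>_mult: "\<pi> (a * b) = \<pi> a \<otimes>\<^bsub>bounded_ops Q\<^esub> \<pi> b"
  by (rule ext) (auto simp: Q.B_ops(1) quotient_rep_def mult.assoc)

lemma \<pi>_norm_le: "vnorm (bounded_ops Q) (\<pi> a) \<le> norm a"
proof (rule Q.opnorm_least)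
  fix x assume "x \<in> carrier Q" and x: "vnorm Q x \<le> 1"
  then obtain y where "x = r y" by auto
  then have "vnorm Q (\<pi> a x) = p (a * y)" "p y \<le> 1" using x by auto
  then show "vnorm Q (\<pi> a x) \<le> norm a"
    using p_mult_le[of a y] mult_left_mono[of "p y" 1 "norm a"] by simp
qed

lemma continuous_rep: "continuous_representation Q \<pi>"
proof -
  interpret B: complex_normed_space "bounded_ops Q" by (rule Q.complex_normed_space_bounded_ops)
  have d: "norm_dist (bounded_ops Q) (\<pi> a) (\<pi> b) \<le> norm (a - b)" for a b
  proof -
    have "\<pi> a \<oplus>\<^bsub>bounded_ops Q\<^esub> (-1) \<odot>\<^bsub>bounded_ops Q\<^esub> \<pi> b = \<pi> (a - b)"
      by (simp add: scaleC_minus_1 flip: \<pi>_scaleC \<pi>_add)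
    then show ?thesis using \<pi>_norm_le[of "a - b"] by (simp add: B.norm_dist_eq \<pi>_closed)
  qed
  have "continuous_map euclidean (norm_topology (bounded_ops Q)) \<pi>"
    unfolding B.continuous_map_norm_topology
  proof (intro ballI allI impI)
    fix a :: 'a and e :: real assume "e > 0"
    then show "\<exists>U. openin euclidean U \<and> a \<in> U \<and> (\<forall>b\<in>U. \<pi> a \<in> carrier (bounded_ops Q) \<and>
        \<pi> b \<in> carrier (bounded_ops Q) \<and> norm_dist (bounded_ops Q) (\<pi> a) (\<pi> b) < e)"
      by (intro exI[of _ "ball a e"]) (auto simp: \<pi>_closed dist_norm intro: le_less_trans[OF d])
  qed
  then show ?thesis
    unfolding continuous_representation_def by (simp add: \<pi>_closed \<pi>_add \<pi>_scaleC \<pi>_mult)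
qed

end

section \<open>Maximal modular left ideals\<close>

lemma (in left_ideal_quotient) left_ideal_sum: "left_ideal {m. \<exists>a. m - a * y \<in> L}"
  unfolding left_ideal_def
proof (intro conjI ballI allI CollectI; (elim CollectE exE)?)
  show "\<exists>a. 0 - a * y \<in> L" by (intro exI[of _ 0]) simp
  fix m a assume m: "m - a * y \<in> L"
  show "\<exists>b. c *\<^sub>C m - b * y \<in> L" for c
    using scaleC_in[OF m, of c] by (intro exI[of _ "c *\<^sub>C a"]) (simp add: scaleC_simps)
  show "\<exists>b. d * m - b * y \<in> L" for d
    using mult_in[OF m, of d] by (intro exI[of _ "d * a"]) (simp add: right_diff_distrib mult.assoc)
  fix n b assume n: "n - b * y \<in> L"
  show "\<exists>b. m + n - b * y \<in> L"
    using add_in[OF m n] by (intro exI[of _ "a + b"]) (simp add: algebra_simps)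
qed

lemma (in left_ideal_quotient) left_ideal_transporter: "left_ideal {x. x * y \<in> L}"
  unfolding left_ideal_def
  by (auto simp: distrib_right add_in mult_scaleC_left scaleC_in mult.assoc mult_in)

locale maximal_modular = left_ideal_quotient +
  assumes max_mod: "maximal_modular_left_ideal L"
begin

lemma proper: "L \<noteq> UNIV"
  and maximal: "left_ideal M \<Longrightarrow> L \<subseteq> M \<Longrightarrow> M = L \<or> M = UNIV"
  using max_mod unfolding maximal_modular_left_ideal_def by blast+

definition u :: 'a where "u = (SOME u. \<forall>a. a - a * u \<in> L)"

lemma u: "a - a * u \<in> L"
  using max_mod someI_ex[of "\<lambda>u. \<forall>a. a - a * u \<in> L"]
  unfolding maximal_modular_left_ideal_def u_def by blast

lemma mult_u_in_iff: "a * u \<in> L \<longleftrightarrow> a \<in> L"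
  using in_cong[OF u] by blast

text \<open>
  Every nonzero vector of \<open>A/L\<close> is cyclic: the vectors killed by all of \<open>A\<close> form a left ideal containing
  \<open>L\<close>, which is not all of \<open>A\<close> by modularity and hence is \<open>L\<close>. So \<open>A y + L\<close> is a left ideal larger
  than \<open>L\<close>.
\<close>

lemma cyclic:
  assumes "y \<notin> L"
  obtains a where "x - a * y \<in> L"
proof -
  have id: "left_ideal {y. \<forall>a. a * y \<in> L}"
    unfolding left_ideal_def
    by (auto simp: distrib_left add_in mult_scaleC_right scaleC_in mult_in simp flip: mult.assoc)
  have "{y. \<forall>a. a * y \<in> L} \<noteq> UNIV"
    using proper mult_u_in_iff by auto
  then have "{y. \<forall>a. a * y \<in> L} = L" using maximal[OF id] mult_in by blast
  with assms obtain b where b: "b * y \<notin> L" by blast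
  have "L \<subseteq> {m. \<exists>a. m - a * y \<in> L}"
    by (auto intro!: exI[of _ 0])
  moreover have "b * y \<in> {m. \<exists>a. m - a * y \<in> L}" by (auto intro!: exI[of _ b])
  ultimately have "{m. \<exists>a. m - a * y \<in> L} = UNIV"
    using maximal[OF left_ideal_sum[of y]] b by blast
  then show thesis using that by blast
qed

text \<open>
  The transporter is the annihilator of the vector \<open>y + L\<close>, and \<open>x \<mapsto> x y + L\<close> identifies \<open>A\<close> modulo
  this annihilator with \<open>A/L\<close>. Any \<open>v\<close> with \<open>v y - y \<in> L\<close> is a modular unit for it.
\<close>

lemma maximal_modular_transporter:
  assumes y: "y \<notin> L"
  shows "maximal_modular_left_ideal {x. x * y \<in> L}"
  unfolding maximal_modular_left_ideal_def
proof (intro conjI allI impI left_ideal_transporter)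
  obtain v where v: "y - v * y \<in> L" using cyclic[OF y] .
  show "{x. x * y \<in> L} \<noteq> UNIV"
  proof
    assume "{x. x * y \<in> L} = UNIV"
    then have "v * y \<in> L" by blast
    then show False using in_cong[OF v] y by simp
  qed
  show "\<exists>v. \<forall>a. a - a * v \<in> {x. x * y \<in> L}"
    using mult_in[OF v] by (intro exI[of _ v]) (auto simp: algebra_simps)
  fix M assume M: "left_ideal M" and sub: "{x. x * y \<in> L} \<subseteq> M"
  interpret M: left_ideal_quotient M by unfold_locales (rule M)
  show "M = {x. x * y \<in> L} \<or> M = UNIV"
  proof (rule disjCI)
    assume "M \<noteq> UNIV"
    have "m * y \<in> L" if m: "m \<in> M" for m
    proof (rule ccontr)
      assume my: "m * y \<notin> L"
      have "x \<in> M" for x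
      proof -
        obtain a where "x * y - a * (m * y) \<in> L" using cyclic[OF my] .
        then have "x - a * m \<in> M" using sub by (auto simp: left_diff_distrib mult.assoc)
        then show "x \<in> M" using M.in_cong M.mult_in[OF m] by blast
      qed
      then show False using \<open>M \<noteq> UNIV\<close> by blast
    qed
    then show "M = {x. x * y \<in> L}" using sub by blast
  qed
qed

text \<open>
  Otherwise \<open>L\<close> is dense and some \<open>l \<in> L\<close> satisfies \<open>norm (u - l) < 1\<close>. Then \<open>t = u - l\<close> is
  quasi-invertible: the fixed point \<open>s = t + s t\<close> exists because \<open>s \<mapsto> t + s t\<close> is a contraction.
  Solving for \<open>u\<close> puts the modular unit into \<open>L\<close>.
\<close>

lemma closed_L: "closed L"
proof (rule ccontr)
  assume nc: "\<not> closed L"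
  \<comment> \<open>The closure of \<open>L\<close>, in a form in which the ideal axioms follow from the seminorm laws.\<close>
  define M where "M = {x. p x = 0}"
  have "L \<noteq> {}" using zero_in by blast
  from in_closure_iff_infdist_zero[OF this] have cl: "M = closure L"
    unfolding M_def by blast
  have "left_ideal M"
    unfolding left_ideal_def M_def
  proof (intro conjI ballI allI CollectI; (elim CollectE)?)
    fix x y c a assume x: "p x = 0"
    show "p (c *\<^sub>C x) = 0" by (simp add: p_scaleC x)
    show "p (a * x) = 0" using p_mult_le[of a x] x infdist_nonneg[of "a * x" L] by simp
    assume "p y = 0"
    then show "p (x + y) = 0" using p_add[of x y] x infdist_nonneg[of "x + y" L] by simp
  qed simp
  moreover have "L \<subseteq> M" by (auto simp: cl closure_def)
  moreover have "M \<noteq> L" using nc cl closed_closure[of L] by metis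
  ultimately have "M = UNIV" using maximal by blast
  then have "u \<in> M" by simp
  then have "p u < 1" by (simp add: M_def)
  then obtain l where l: "l \<in> L" "norm (u - l) < 1" unfolding p_less_iff by blast
  define t where "t = u - l"
  have "\<exists>!s. t + s * t = s"
  proof (rule banach_fix_type[of "norm t"])
    show "\<forall>s s'. dist (t + s * t) (t + s' * t) \<le> norm t * dist s s'"
    proof (intro allI)
      fix s s'
      show "dist (t + s * t) (t + s' * t) \<le> norm t * dist s s'"
        using norm_mult_ineq[of "s - s'" t] by (simp add: dist_norm mult.commute left_diff_distrib)
    qed
  qed (use l in \<open>simp_all add: t_def\<close>)
  then obtain s where s: "t + s * t = s" by blast
  have "u = l + (s - s * u) + s * l" using s by (simp add: t_def algebra_simps)
  then have "u \<in> L" using l(1) u[of s] mult_in[OF l(1), of s] add_in by metis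
  then show False using proper mult_in mult_u_in_iff by blast
qed

sublocale closed_left_ideal L
  by unfold_locales (rule closed_L)

lemma irreducible: "irreducible_rep Q \<pi>"
  unfolding irreducible_rep_def
proof (intro conjI allI impI)
  obtain a where "a \<notin> L" using proper by blast
  then show "\<exists>a. \<pi> a \<noteq> \<zero>\<^bsub>bounded_ops Q\<^esub>"
    using mult_u_in_iff unfolding kernel_iff by blast
  fix Y assume Y: "submodule Y complex_ring Q" and inv: "\<forall>a. \<pi> a ` Y \<subseteq> Y"
  note E = Q.submoduleE[OF Y]
  have "Y = carrier Q" if y: "y \<in> Y" "y \<noteq> \<zero>\<^bsub>Q\<^esub>" for y
  proof -
    obtain x where x: "y = r x" using E(1) y by auto
    then have "x \<notin> L" using y by (simp add: r_eq_0_iff)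
    have "r z \<in> Y" for z
    proof -
      obtain a where "z - a * x \<in> L" using cyclic[OF \<open>x \<notin> L\<close>] .
      then have "r z = \<pi> a y" by (simp add: x r_eq_iff)
      then show ?thesis using inv y by blast
    qed
    then show ?thesis using E(1) by auto
  qed
  moreover have "\<zero>\<^bsub>Q\<^esub> \<in> Y"
  proof -
    obtain y where y: "y \<in> Y" using E(2) by blast
    then have "0 \<odot>\<^bsub>Q\<^esub> y \<in> Y" using E(4)[of 0 y] by (simp add: complex_ring_def)
    then show ?thesis by simp
  qed
  ultimately show "Y = {\<zero>\<^bsub>Q\<^esub>} \<or> Y = carrier Q" by blast
qed

lemma not_dim_2:
  assumes "\<And>a. \<exists>c. a - c *\<^sub>C e \<in> L"
  shows "\<not> dim_at_least 2 Q"
proof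
  assume "dim_at_least 2 Q"
  then obtain v where v: "v \<in> {..<2} \<rightarrow> carrier Q"
    "\<And>c. (\<Oplus>\<^bsub>Q\<^esub> i \<in> {..<2}. c i \<odot>\<^bsub>Q\<^esub> v i) = \<zero>\<^bsub>Q\<^esub> \<Longrightarrow> \<forall>i<2::nat. c i = 0"
    unfolding dim_at_least_def by blast
  have "\<exists>c. x = r (c *\<^sub>C e)" if "x \<in> carrier Q" for x
    using that assms by (auto simp: r_eq_iff)
  then obtain c d where cd: "v 0 = r (c *\<^sub>C e)" "v 1 = r (d *\<^sub>C e)"
    using v(1) by (metis Pi_iff lessThan_iff pos2 one_less_numeral_iff semiring_norm(76))
  have sum: "(\<Oplus>\<^bsub>Q\<^esub> i \<in> {..<2}. k i \<odot>\<^bsub>Q\<^esub> v i) = r ((k 0 * c + k 1 * d) *\<^sub>C e)" for k :: "nat \<Rightarrow> complex"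
  proof -
    have "{..<2::nat} = {0, 1}" by auto
    then have "(\<Oplus>\<^bsub>Q\<^esub> i \<in> {..<2}. k i \<odot>\<^bsub>Q\<^esub> v i) = k 0 \<odot>\<^bsub>Q\<^esub> v 0 \<oplus>\<^bsub>Q\<^esub> k 1 \<odot>\<^bsub>Q\<^esub> v 1"
      using cd by (simp add: Q.M.finsum_insert)
    also have "\<dots> = r ((k 0 * c + k 1 * d) *\<^sub>C e)" using cd by (simp add: scaleC_simps)
    finally show ?thesis .
  qed
  have indep: "k 0 = 0 \<and> k 1 = 0" if "k 0 * c + k 1 * d = 0" for k :: "nat \<Rightarrow> complex"
  proof -
    have "(\<Oplus>\<^bsub>Q\<^esub> i \<in> {..<2}. k i \<odot>\<^bsub>Q\<^esub> v i) = \<zero>\<^bsub>Q\<^esub>" unfolding sum that by simp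
    from v(2)[OF this] show ?thesis by simp
  qed
  show False
  proof (cases "c = 0 \<and> d = 0")
    case True
    then show False using indep[of "\<lambda>_. 1"] by simp
  next
    case False
    then show False using indep[of "\<lambda>i. if i = 0 then d else - c"] by (simp add: mult.commute)
  qed
qed

end

lemma maximal_modularI: "maximal_modular_left_ideal L \<Longrightarrow> maximal_modular L"
  by unfold_locales (simp_all add: maximal_modular_left_ideal_def)

lemma jacobson_radical_eq_kernels:
  "(\<Inter>L\<in>{L. maximal_modular_left_ideal L}. rep_kernel (quotient_space L) (quotient_rep L))
     = (jacobson_radical :: 'a::complex_banach_algebra set)"
proof (intro subset_antisym subsetI)
  fix a :: 'a assume a: "a \<in> (\<Inter>L\<in>{L. maximal_modular_left_ideal L}. rep_kernel (quotient_space L) (quotient_rep L))"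
  show "a \<in> jacobson_radical" unfolding jacobson_radical_def
  proof (intro InterI, elim CollectE)
    fix L :: "'a set" assume L: "maximal_modular_left_ideal L"
    interpret maximal_modular L by (rule maximal_modularI[OF L])
    have "\<pi> a = \<zero>\<^bsub>bounded_ops Q\<^esub>" using a L by (auto simp: rep_kernel_def)
    then have "a * u \<in> L" by (simp only: kernel_iff)
    then show "a \<in> L" by (simp only: mult_u_in_iff)
  qed
next
  fix a :: 'a assume a: "a \<in> jacobson_radical"
  show "a \<in> (\<Inter>L\<in>{L. maximal_modular_left_ideal L}. rep_kernel (quotient_space L) (quotient_rep L))"
  proof (intro INT_I, elim CollectE)
    fix L :: "'a set" assume L: "maximal_modular_left_ideal L"
    interpret maximal_modular L by (rule maximal_modularI[OF L])
    have "a * y \<in> L" for y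
    proof (cases "y \<in> L")
      case False
      show ?thesis using a maximal_modular_transporter[OF False] by (auto simp: jacobson_radical_def)
    qed (rule mult_in)
    then show "a \<in> rep_kernel Q \<pi>" by (simp add: rep_kernel_def kernel_iff)
  qed
qed

section \<open>A Gelfand--Mazur theorem\<close>

text \<open>
  The commutative field \<open>A/L\<close> with unit \<open>e + L\<close>, described by congruences modulo \<open>L\<close>; its norm is the
  distance to \<open>L\<close>.
\<close>

locale complex_field_quotient = closed_left_ideal +
  fixes e :: 'a
  assumes mult_in_right: "x \<in> L \<Longrightarrow> x * a \<in> L"
    and unit_left: "e * a - a \<in> L" and unit_right: "a * e - a \<in> L"
    and commute: "a * b - b * a \<in> L"
    and inverse: "a \<notin> L \<Longrightarrow> \<exists>b. b * a - e \<in> L"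
begin

lemma p_mult: "p (x * y) \<le> p x * p y"
proof -
  have *: "p (x * y) \<le> b * c" if xy: "p x < b" "p y < c" for b c
  proof -
    obtain l m where lm: "l \<in> L" "m \<in> L" "norm (x - l) < b" "norm (y - m) < c"
      using xy unfolding p_less_iff by blast
    have "x * y - (x - l) * (y - m) = l * y + (x - l) * m" by (simp add: algebra_simps)
    then have "p (x * y) = p ((x - l) * (y - m))"
      using lm by (intro p_cong) (simp add: add_in mult_in mult_in_right)
    also have "\<dots> \<le> norm (x - l) * norm (y - m)" using p_le_norm norm_mult_ineq order_trans by blast
    also have "\<dots> \<le> b * c"
      using lm norm_ge_zero[of "x - l"] by (intro mult_mono) (linarith | simp)+
    finally show ?thesis .
  qed
  have "((\<lambda>d. (p x + d) * (p y + d)) \<longlongrightarrow> (p x + 0) * (p y + 0)) (at_right 0)"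
    by (intro tendsto_intros)
  moreover have "\<forall>\<^sub>F d in at_right 0. p (x * y) \<le> (p x + d) * (p y + d)"
    using eventually_at_right_less[of "0::real"] by eventually_elim (rule *, auto)
  ultimately show ?thesis
    using tendsto_lowerbound[OF _ _ trivial_limit_at_right_real] by force
qed

definition resolvent :: "'a \<Rightarrow> complex \<Rightarrow> 'a" where
  "resolvent a z = (SOME b. b * (a - z *\<^sub>C e) - e \<in> L)"

context
  fixes a :: 'a
  assumes no_eigenvalue: "\<And>z. a - z *\<^sub>C e \<notin> L"
begin

abbreviation R :: "complex \<Rightarrow> 'a" where "R \<equiv> resolvent a"

lemma R_left: "R z * (a - z *\<^sub>C e) - e \<in> L"
  unfolding resolvent_def by (rule someI_ex[OF inverse[OF no_eigenvalue]])

lemma R_right: "(a - z *\<^sub>C e) * R z - e \<in> L"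
  by (rule diff_trans[OF commute R_left])

lemma resolvent_identity: "R w - R z - (w - z) *\<^sub>C (R w * R z) \<in> L"
proof -
  have "(R w * (a - w *\<^sub>C e) - e) * R z + (e * R z - R z) - (R w * ((a - z *\<^sub>C e) * R z - e) + (R w * e - R w))
      - (w - z) *\<^sub>C (R w * (R z - e * R z)) = R w - R z - (w - z) *\<^sub>C (R w * R z)"
    by (simp add: algebra_simps scaleC_simps)
  moreover have "\<dots> \<in> L" unfolding calculation[symmetric]
    by (intro add_in diff_in mult_in_right mult_in scaleC_in R_left R_right unit_left unit_right
        diff_sym[OF unit_left])
  ultimately show ?thesis by simp
qed

text \<open>
  The resolvent identity \<open>R(w) = x + d R(w) x\<close> substituted into itself twice, with \<open>d = w - z\<close> and
  \<open>x = R(z)\<close>. It replaces the power series of the resolvent at \<open>z\<close>.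
\<close>

lemma resolvent_expansion:
  fixes w z :: complex defines "d \<equiv> w - z" and "x \<equiv> R z"
  shows "R w - (x + d *\<^sub>C (x * x) + (d ^ 2) *\<^sub>C (x * x * x) + (d ^ 3) *\<^sub>C (R w * x * x * x)) \<in> L"
proof -
  define E where "E = R w - x - d *\<^sub>C (R w * x)"
  have E: "E \<in> L" unfolding E_def d_def x_def by (rule resolvent_identity)
  have "E + d *\<^sub>C (E * x) + (d ^ 2) *\<^sub>C (E * x * x)
      = R w - (x + d *\<^sub>C (x * x) + (d ^ 2) *\<^sub>C (x * x * x) + (d ^ 3) *\<^sub>C (R w * x * x * x))"
    by (simp add: E_def algebra_simps scaleC_simps power2_eq_square power3_eq_cube)
  moreover have "\<dots> \<in> L" unfolding calculation[symmetric]
    by (intro add_in scaleC_in mult_in_right E)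
  ultimately show ?thesis by simp
qed

text \<open>
  In the sum of the expansions at \<open>z \<plusminus> t\<close> and \<open>z \<plusminus> \<i>t\<close>, the terms of first and second order cancel,
  since the first and second powers of the fourth roots of unity sum to \<open>0\<close>. The remainders are of third
  order.
\<close>

lemma resolvent_mean:
  assumes t: "t > 0"
  shows "4 * p (R z) \<le> (1 + t ^ 3 * p (R z) ^ 3) * (p (R (z + of_real t)) + p (R (z - of_real t))
     + p (R (z + \<i> * of_real t)) + p (R (z - \<i> * of_real t)))"
proof -
  define c where "c = complex_of_real t"
  define x where "x = R z"
  define y1 y2 y3 y4 where "y1 = R (z + c)" and "y2 = R (z - c)" and "y3 = R (z + \<i> * c)" and "y4 = R (z - \<i> * c)"
  define A where "A = c *\<^sub>C (x * x)"
  define B where "B = c ^ 2 *\<^sub>C (x * x * x)"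
  define W where "W y = c ^ 3 *\<^sub>C (y * x * x * x)" for y
  define Z where "Z = W y1 - W y2 - \<i> *\<^sub>C W y3 + \<i> *\<^sub>C W y4"
  have i3: "\<i> ^ 3 = - \<i>" by (simp add: power3_eq_cube)
  have "y1 - (x + A + B + W y1) \<in> L"
    using resolvent_expansion[of "z + c" z] by (simp add: y1_def A_def B_def W_def x_def)
  moreover have "y2 - (x - A + B - W y2) \<in> L"
    using resolvent_expansion[of "z - c" z]
    by (simp add: y2_def A_def B_def W_def x_def scaleC_minus_left)
  moreover have "y3 - (x + \<i> *\<^sub>C A - B - \<i> *\<^sub>C W y3) \<in> L"
    using resolvent_expansion[of "z + \<i> * c" z]
    by (simp add: y3_def A_def B_def W_def x_def scaleC_minus_left scaleC_scaleC power_mult_distrib i3)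
  moreover have "y4 - (x - \<i> *\<^sub>C A - B + \<i> *\<^sub>C W y4) \<in> L"
    using resolvent_expansion[of "z - \<i> * c" z]
    by (simp add: y4_def A_def B_def W_def x_def scaleC_minus_left scaleC_scaleC power_mult_distrib i3)
  ultimately have "(y1 - (x + A + B + W y1)) + (y2 - (x - A + B - W y2))
      + (y3 - (x + \<i> *\<^sub>C A - B - \<i> *\<^sub>C W y3)) + (y4 - (x - \<i> *\<^sub>C A - B + \<i> *\<^sub>C W y4)) \<in> L"
    by (intro add_in)
  moreover have x4: "4 *\<^sub>C x = x + x + x + x"
    using scaleC_add_left[of 2 2 x] scaleC_add_left[of 1 1 x] by simp
  ultimately have "(y1 + y2 + y3 + y4 - Z) - 4 *\<^sub>C x \<in> L"
    by (simp add: Z_def algebra_simps)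
  then have "p (4 *\<^sub>C x) = p (y1 + y2 + y3 + y4 - Z)" by (rule p_cong[symmetric])
  also have "\<dots> \<le> p y1 + p y2 + p y3 + p y4 + p Z"
    using p_add[of "y1 + y2 + y3 + y4" "- Z"] p_add[of "y1 + y2 + y3" y4] p_add[of "y1 + y2" y3]
      p_add[of y1 y2] by (simp add: p_minus)
  also have "p Z \<le> p (W y1) + p (W y2) + p (W y3) + p (W y4)"
    using p_add[of "W y1 - W y2 - \<i> *\<^sub>C W y3" "\<i> *\<^sub>C W y4"]
      p_add[of "W y1 - W y2" "- (\<i> *\<^sub>C W y3)"] p_add[of "W y1" "- W y2"]
    by (simp add: Z_def p_minus p_scaleC)
  finally have le: "p (4 *\<^sub>C x) \<le> p y1 + p y2 + p y3 + p y4 + (p (W y1) + p (W y2) + p (W y3) + p (W y4))" by simp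
  have pW: "p (W y) \<le> t ^ 3 * p x ^ 3 * p y" for y
  proof -
    have "p (y * x * x * x) \<le> p (y * x * x) * p x" by (rule p_mult)
    also have "\<dots> \<le> p (y * x) * p x * p x" by (intro mult_right_mono p_mult infdist_nonneg)
    also have "\<dots> \<le> p y * p x * p x * p x" by (intro mult_right_mono p_mult infdist_nonneg)
    finally have "t ^ 3 * p (y * x * x * x) \<le> t ^ 3 * (p y * p x * p x * p x)"
      using t by (intro mult_left_mono) auto
    also have "\<dots> = t ^ 3 * p x ^ 3 * p y" by (simp only: power3_eq_cube mult_ac)
    finally show ?thesis using t by (simp add: W_def p_scaleC c_def norm_power)
  qed
  then have "p (W y1) + p (W y2) + p (W y3) + p (W y4) \<le> t ^ 3 * p x ^ 3 * (p y1 + p y2 + p y3 + p y4)"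
    unfolding distrib_left by (intro add_mono)
  with le show ?thesis
    by (simp add: p_scaleC distrib_right x_def y1_def y2_def y3_def y4_def c_def)
qed

text \<open>
  Near \<open>z\<close>, where \<open>|w - z| p(R(z)) < 1/2\<close>, the resolvent identity first bounds \<open>p(R(w))\<close> by
  \<open>2 p(R(z))\<close>, and with this bound it gives continuity.
\<close>

lemma resolvent_continuous: "continuous_on UNIV (\<lambda>z. p (R z))"
proof -
  have step: "\<bar>p (R w) - p (R z)\<bar> \<le> cmod (w - z) * (p (R w) * p (R z))" for w z
  proof -
    have "p (R w - R z) = p ((w - z) *\<^sub>C (R w * R z))" by (rule p_cong[OF resolvent_identity])
    also have "\<dots> \<le> cmod (w - z) * (p (R w) * p (R z))"
      by (simp add: p_scaleC p_mult mult_left_mono)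
    finally show ?thesis
      using p_add[of "R w - R z" "R z"] p_add[of "R z - R w" "R w"] p_diff_sym[of "R w" "R z"] by simp
  qed
  have "isCont (\<lambda>z. p (R z)) z" for z
  proof -
    let ?m = "p (R z)"
    have lim: "((\<lambda>w. cmod (w - z) * b) \<longlongrightarrow> 0) (at z)" for b
      by (intro tendsto_mult_left_zero tendsto_norm_zero) (simp add: LIM_zero_iff)
    have "\<forall>\<^sub>F w in at z. cmod (w - z) * ?m < 1/2"
      by (rule order_tendstoD(2)[OF lim]) simp
    then have "\<forall>\<^sub>F w in at z. norm (p (R w) - ?m) \<le> cmod (w - z) * (2 * ?m * ?m)"
    proof eventually_elim
      case (elim w)
      have "p (R w) * (cmod (w - z) * ?m) \<le> p (R w) * (1/2)"
        using elim by (intro mult_left_mono infdist_nonneg) auto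
      then have "p (R w) \<le> 2 * ?m" using step[of w z] by (simp add: algebra_simps)
      then have "p (R w) * ?m \<le> 2 * ?m * ?m" by (intro mult_right_mono infdist_nonneg)
      then have "cmod (w - z) * (p (R w) * ?m) \<le> cmod (w - z) * (2 * ?m * ?m)"
        by (intro mult_left_mono) auto
      then show ?case using step[of w z] by simp
    qed
    then have "((\<lambda>w. p (R w) - ?m) \<longlongrightarrow> 0) (at z)"
      by (rule Lim_null_comparison[OF _ lim])
    then show ?thesis unfolding isCont_def by (simp add: LIM_zero_iff)
  qed
  then show ?thesis by (simp add: continuous_at_imp_continuous_on)
qed

lemma resolvent_decay: "((\<lambda>z. p (R z)) \<longlongrightarrow> 0) at_infinity"
proof (rule Lim_null_comparison)
  have bound: "p (R z) * (cmod z - p a) \<le> p e" for z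
  proof -
    have "z *\<^sub>C R z - (R z * a - e) = - ((R z * (a - z *\<^sub>C e) - e) + z *\<^sub>C (R z * e - R z))"
      by (simp add: algebra_simps scaleC_simps)
    moreover have "\<dots> \<in> L" by (intro minus_in add_in scaleC_in R_left unit_right)
    ultimately have "p (z *\<^sub>C R z) = p (R z * a - e)" using p_cong by metis
    also have "\<dots> \<le> p (R z) * p a + p e"
      using p_add[of "R z * a" "- e"] p_mult[of "R z" a] by (simp add: p_minus)
    finally show ?thesis by (simp add: p_scaleC algebra_simps)
  qed
  have "\<forall>\<^sub>F z in at_infinity. p a + 1 \<le> cmod z" by (auto simp: eventually_at_infinity)
  then show "\<forall>\<^sub>F z in at_infinity. norm (p (R z)) \<le> p e / (cmod z - p a)"
  proof eventually_elim
    case (elim z)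
    then show ?case using bound[of z] infdist_nonneg[of "R z" L] by (simp add: field_simps)
  qed
  have "filterlim (\<lambda>z. - p a + cmod z) at_top at_infinity"
    by (rule filterlim_tendsto_add_at_top[OF tendsto_const filterlim_norm_at_top])
  then show "((\<lambda>z. p e / (cmod z - p a)) \<longlongrightarrow> 0) at_infinity"
    by (intro tendsto_divide_0[OF tendsto_const] filterlim_at_top_imp_at_infinity) simp
qed

lemma no_eigenvalue_imp_unit_in: "e \<in> L"
proof -
  have "p (R 0) = 0"
    by (rule decaying_subharmonic_eq_0[of "\<lambda>z. p (R z)", OF infdist_nonneg resolvent_continuous
        resolvent_decay resolvent_mean])
  then have "R 0 \<in> L" by (simp add: p_eq_0_iff)
  then have "R 0 * (a - 0 *\<^sub>C e) \<in> L" by (rule mult_in_right)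
  then show ?thesis using in_cong[OF R_left[of 0]] by blast
qed

end

text \<open>
  If \<open>a\<close> had no eigenvalue, the resolvent would vanish modulo \<open>L\<close>, although it is inverse to
  \<open>a - z\<close>; then \<open>L\<close> would be the whole algebra, in which \<open>0\<close> is an eigenvalue.
\<close>

theorem Gelfand_Mazur: "\<exists>c. a - c *\<^sub>C e \<in> L"
proof (rule ccontr)
  assume "\<nexists>c. a - c *\<^sub>C e \<in> L"
  then have "e \<in> L" using no_eigenvalue_imp_unit_in by blast
  then have "a * e \<in> L" by (rule mult_in)
  then have "a - 0 *\<^sub>C e \<in> L" using in_cong[OF unit_right[of a]] by simp
  then show False using \<open>\<nexists>c. a - c *\<^sub>C e \<in> L\<close> by blast
qed

end

section \<open>From the property B to one-dimensional quotients\<close>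

context maximal_modular
begin

text \<open>
  The property \<open>B\<close> is applied to \<open>\<phi>(a, b) = b c a y + L\<close>: if \<open>a b = 0\<close>, then \<open>b c a\<close> has square \<open>0\<close>.
\<close>

lemma commutator_in:
  assumes B: "property_B TYPE('a)" and q: "\<And>q y. q * q = 0 \<Longrightarrow> q * y \<in> L"
  shows "(d * c * a) * b * y - b * (d * c * a) * y \<in> L"
proof -
  define \<phi> where "\<phi> a b = r (b * c * a * y)" for a b
  have "continuous_bilinear Q \<phi>"
    unfolding continuous_bilinear_def
  proof (intro conjI)
    show "continuous_map euclidean (norm_topology Q) (\<lambda>(a, b). \<phi> a b)"
      unfolding Q.continuous_map_norm_topology
    proof (intro ballI allI impI)
      fix v :: "'a \<times> 'a" and \<epsilon> :: real assume "\<epsilon> > 0"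
      have "continuous_on UNIV (\<lambda>w::'a \<times> 'a. snd w * c * fst w * y)"
        by (intro continuous_intros)
      then have "open ((\<lambda>w. snd w * c * fst w * y) -` ball (snd v * c * fst v * y) \<epsilon>)"
        by (intro open_vimage) auto
      then show "\<exists>U. openin euclidean U \<and> v \<in> U \<and> (\<forall>w\<in>U. (\<lambda>(a, b). \<phi> a b) v \<in> carrier Q \<and>
          (\<lambda>(a, b). \<phi> a b) w \<in> carrier Q \<and> norm_dist Q ((\<lambda>(a, b). \<phi> a b) v) ((\<lambda>(a, b). \<phi> a b) w) < \<epsilon>)"
        using \<open>\<epsilon> > 0\<close>
        by (intro exI[of _ "(\<lambda>w. snd w * c * fst w * y) -` ball (snd v * c * fst v * y) \<epsilon>"])
          (auto simp: \<phi>_def split_beta dist_norm intro: le_less_trans[OF p_le_norm])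
    qed
  qed (auto simp: \<phi>_def algebra_simps scaleC_simps)
  moreover have "\<phi> a b = \<zero>\<^bsub>Q\<^esub>" if "a * b = 0" for a b
  proof -
    have "(b * c * a) * (b * c * a) = b * c * (a * b) * c * a" by (simp add: mult.assoc)
    then have "b * c * a * y \<in> L" using that by (intro q) simp
    then show ?thesis by (simp add: \<phi>_def r_eq_0_iff)
  qed
  ultimately have "\<phi> (a * b) d = \<phi> a (b * d)"
    using property_B_imp_property_B_on[OF B, where 'x='a] Q_banach
    unfolding property_B_on_def by blast
  then show ?thesis by (simp add: \<phi>_def r_eq_iff mult.assoc)
qed

text \<open>
  The element \<open>e = u\<^sup>3\<close> is still a right unit modulo \<open>L\<close>. Being a product of three elements, it commutes
  with everything modulo \<open>L\<close>, so it is also a left unit. Hence every \<open>a\<close> is congruent to \<open>e a\<close>, again a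
  product of three elements, so the commutation with such products extends to all of \<open>A\<close>.
\<close>

lemma one_dimensional:
  assumes comm: "\<And>a b c d y. (d * c * a) * b * y - b * (d * c * a) * y \<in> L"
  shows "\<exists>e. \<forall>a. \<exists>c. a - c *\<^sub>C e \<in> L"
proof -
  define e where "e = u * u * u"
  have ur: "a * (u * u * u) - a \<in> L" for a
  proof -
    have "a * (u * u * u) - a = - ((a - a * u) + (a * u - a * u * u) + (a * u * u - a * u * u * u))"
      by (simp add: mult.assoc)
    also have "\<dots> \<in> L" by (intro minus_in add_in u)
    finally show ?thesis .
  qed
  have ul: "e * a - a \<in> L" for a
  proof -
    have "e * a * u - a * e * u \<in> L" unfolding e_def by (rule comm)
    moreover have "e * a - e * a * u \<in> L" "a * e - a * e * u \<in> L" by (rule u)+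
    ultimately have "e * a - a * e \<in> L" using diff_trans diff_sym by metis
    then show ?thesis by (rule diff_trans) (simp add: e_def ur)
  qed
  have comm': "(d * c * a) * b - b * (d * c * a) \<in> L" for a b c d
    by (rule diff_trans[OF u diff_trans[OF comm diff_sym[OF u]]])
  have right: "x * a \<in> L" if x: "x \<in> L" for x a
  proof -
    \<comment> \<open>The product \<open>e a x\<close> lies in the left ideal \<open>L\<close>, hence so does \<open>x e a\<close>.\<close>
    have "(u * u * (u * a)) * x - x * (u * u * (u * a)) \<in> L" by (rule comm')
    then have "x * (u * u * (u * a)) \<in> L" using in_cong mult_in[OF x] by blast
    then have "x * (e * a) \<in> L" by (simp add: e_def mult.assoc)
    moreover have "x * (e * a) - x * a \<in> L" using mult_in[OF ul[of a], of x] by (simp add: right_diff_distrib)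
    ultimately show ?thesis using in_cong by blast
  qed
  have commute: "a * b - b * a \<in> L" for a b
  proof -
    have "(e * a) * b - b * (e * a) \<in> L" using comm'[of u u "u * a" b] by (simp add: e_def mult.assoc)
    moreover have "(e * a) * b - a * b \<in> L" using right[OF ul[of a], of b] by (simp add: left_diff_distrib)
    moreover have "b * (e * a) - b * a \<in> L" using mult_in[OF ul[of a], of b] by (simp add: right_diff_distrib)
    ultimately show ?thesis using diff_trans diff_sym by metis
  qed
  interpret complex_field_quotient L e
  proof
    show "\<exists>b. b * a - e \<in> L" if "a \<notin> L" for a
      using cyclic[OF that, of e] diff_sym by metis
  qed (use right ul ur commute in \<open>auto simp: e_def\<close>)
  show ?thesis using Gelfand_Mazur by blast
qed

end

theorem mainTheorem2:
  assumes "property_B TYPE('a::complex_banach_algebra)"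
  shows "property_beta TYPE('a)"
proof (rule property_beta_on_imp_property_beta)
  show "property_beta_on TYPE('a) TYPE('a set) TYPE('a)"
    unfolding property_beta_on_def
  proof (intro exI[of _ "{L. maximal_modular_left_ideal L}"] exI[of _ quotient_space]
      exI[of _ quotient_rep] conjI ballI impI)
    show "(\<Inter>L\<in>{L. maximal_modular_left_ideal L}. rep_kernel (quotient_space L) (quotient_rep L))
        = (jacobson_radical :: 'a set)" by (rule jacobson_radical_eq_kernels)
    fix L :: "'a set" assume "L \<in> {L. maximal_modular_left_ideal L}"
    then interpret maximal_modular L by (intro maximal_modularI) simp
    show "complex_banach_space Q" by (rule Q_banach)
    show "continuous_representation Q \<pi>" by (rule continuous_rep)
    show "irreducible_rep Q \<pi>" by (rule irreducible)
    assume dim: "dim_at_least 2 Q"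
    show "\<exists>q. q * q = 0 \<and> \<pi> q \<noteq> \<zero>\<^bsub>bounded_ops Q\<^esub>"
    proof (rule ccontr)
      assume "\<nexists>q. q * q = 0 \<and> \<pi> q \<noteq> \<zero>\<^bsub>bounded_ops Q\<^esub>"
      then have "q * y \<in> L" if "q * q = 0" for q y using that kernel_iff by blast
      from one_dimensional[OF commutator_in[OF assms this]] show False using not_dim_2 dim by metis
    qed
  qed
qed

end
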